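(* Let $r\ge 0$ be a fixed integer and let $(b_k)_{k=1}^\infty$ be a positive integer sequence of degree $r$. There exists an algorithm that, given a positive integer $n$, outputs a weighted partition of size $n$ with $b_k$ types of summands of size $k$, uniformly at random among all such weighted partitions of size $n$, runs in expected time $O\big(n^{r+1+(r+3)/(2r+4)}\big)$, and uses $O(n)$ space.
   Context: A positive integer sequence of degree $r$ is a sequence of positive integers $(b_k)_{k\ge1}$ such that $b_k=p(k)$ for all $k\ge1$, for some real polynomial $p(x)=a_0+a_1x+\dots+a_rx^r$ with $\deg p=r$. The class of weighted partitions with $b_k$ types of summands of size $k\ge1$ consists of finite multisets of typed summands (a summand of size $k$ carries one of $b_k$ types); the size of such an object is the sum of the sizes of its summands, so the counting sequence satisfies $\sum_{n\ge0}c_nz^n=\prod_{k\ge1}(1-z^k)^{-b_k}$. Model of computation: the real-arithmetic model, with an oracle that evaluates a generating function at any point within its radius of convergence in constant time and a root-finding oracle returning exact roots in constant time; random variables such as geometric random variables can be sampled in time proportional to the value output. *)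

theory Defs
  imports
    "HOL-Probability.Probability"
    "HOL-Computational_Algebra.Polynomial"
    "HOL-Library.Landau_Symbols"
begin

section \<open>Weighted partitions\<close>

definition pos_int_seq_of_degree :: "nat \<Rightarrow> (nat \<Rightarrow> nat) \<Rightarrow> bool" where
  "pos_int_seq_of_degree r b \<longleftrightarrow>
     (\<forall>k\<ge>1. 0 < b k) \<and>
     (\<exists>p :: real poly. degree p = r \<and> (\<forall>k\<ge>1. real (b k) = poly p (real k)))"

text \<open>A summand of size \<open>k\<close> and type \<open>j\<close> is the pair \<open>(k, j)\<close>; types are numbered from 1.\<close>

definition weighted_partitions :: "(nat \<Rightarrow> nat) \<Rightarrow> nat \<Rightarrow> (nat \<times> nat) multiset set" where
  "weighted_partitions b n =
     {P. (\<forall>(k, j) \<in># P. 1 \<le> k \<and> 1 \<le> j \<and> j \<le> b k) \<and> (\<Sum>(k, j) \<in># P. k) = n}"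

lemma finite_weighted_partitions: "finite (weighted_partitions b n)"
proof -
  define A where "A = (SIGMA k:{..n}. {..b k})"
  have A: "finite A" by (simp add: A_def)
  have sub: "weighted_partitions b n \<subseteq> (\<Union>m\<le>n. multisets_of_size A m)"
  proof
    fix P assume P: "P \<in> weighted_partitions b n"
    have pos: "1 \<le> fst x" and ty: "snd x \<le> b (fst x)" if "x \<in># P" for x
      using P that by (auto simp: weighted_partitions_def case_prod_unfold)
    have n: "(\<Sum>x\<in>#P. fst x) = n"
      using P by (simp add: weighted_partitions_def case_prod_unfold)
    have "size P = (\<Sum>x\<in>#P. 1)" by simp
    also have "\<dots> \<le> (\<Sum>x\<in>#P. fst x)" by (intro sum_mset_mono pos)
    finally have "size P \<le> n" using n by simp
    moreover have "fst x \<le> n" if "x \<in># P" for x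
      using n multi_member_split[OF that] by auto
    hence "set_mset P \<subseteq> A" using ty by (force simp: A_def)
    ultimately show "P \<in> (\<Union>m\<le>n. multisets_of_size A m)"
      by (auto simp: multisets_of_size_def)
  qed
  show ?thesis
    by (rule finite_subset[OF sub]) (use finite_multisets_of_size[OF A] in auto)
qed

definition counting_gf :: "(nat \<Rightarrow> nat) \<Rightarrow> real fps" where
  "counting_gf b = Abs_fps (\<lambda>n. real (card (weighted_partitions b n)))"


section \<open>Randomised real-arithmetic machine with oracles\<close>

text \<open>
  Programs work on real-valued registers and an array of real-valued cells. A program text is
  finite, contains integer constants only (so that no advice can be hidden in a real constant),
  and mentions finitely many registers and expressions of bounded size; hence charging one unit
  of time per elementary command and one unit of space per array cell is accurate up to
  constants depending on the program alone. There is no rounding operation.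

  \<open>GF i e\<close> is the evaluation oracle for the \<open>i\<close>-th derivative of the counting generating
  function (\<open>i = 0\<close> being the generating function itself).
\<close>

datatype aexp =
    Const int
  | Reg nat
  | Plus aexp aexp
  | Minus aexp aexp
  | Times aexp aexp
  | Divide aexp aexp
  | GF nat aexp

datatype bexp =
    Lt aexp aexp
  | Neg bexp
  | Conj bexp bexp

datatype com =
    Skip
  | Assign nat aexp
  | Load nat aexp
  | Store aexp aexp
  | Geometric nat aexp
  | Bernoulli nat aexp
  | FindRoot nat aexp aexp aexp
  | Seq com com
  | Cond bexp com com
  | While bexp com

definition gf_deriv :: "(nat \<Rightarrow> nat) \<Rightarrow> nat \<Rightarrow> real fps" where
  "gf_deriv b i = (fps_deriv ^^ i) (counting_gf b)"

primrec aval :: "(nat \<Rightarrow> nat) \<Rightarrow> (nat \<Rightarrow> real) \<Rightarrow> aexp \<Rightarrow> real" where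
  "aval b \<rho> (Const c) = of_int c"
| "aval b \<rho> (Reg v) = \<rho> v"
| "aval b \<rho> (Plus e f) = aval b \<rho> e + aval b \<rho> f"
| "aval b \<rho> (Minus e f) = aval b \<rho> e - aval b \<rho> f"
| "aval b \<rho> (Times e f) = aval b \<rho> e * aval b \<rho> f"
| "aval b \<rho> (Divide e f) = aval b \<rho> e / aval b \<rho> f"
| "aval b \<rho> (GF i e) =
     (if ereal \<bar>aval b \<rho> e\<bar> < fps_conv_radius (gf_deriv b i)
      then eval_fps (gf_deriv b i) (aval b \<rho> e) else 0)"

text \<open>
  \<open>well_def\<close> excludes division by zero and evaluation outside the disc of convergence, so that
  the totalised values of \<open>aval\<close> do not produce spurious roots for the root-finding oracle.
\<close>

primrec well_def :: "(nat \<Rightarrow> nat) \<Rightarrow> (nat \<Rightarrow> real) \<Rightarrow> aexp \<Rightarrow> bool" where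
  "well_def b \<rho> (Const c) \<longleftrightarrow> True"
| "well_def b \<rho> (Reg v) \<longleftrightarrow> True"
| "well_def b \<rho> (Plus e f) \<longleftrightarrow> well_def b \<rho> e \<and> well_def b \<rho> f"
| "well_def b \<rho> (Minus e f) \<longleftrightarrow> well_def b \<rho> e \<and> well_def b \<rho> f"
| "well_def b \<rho> (Times e f) \<longleftrightarrow> well_def b \<rho> e \<and> well_def b \<rho> f"
| "well_def b \<rho> (Divide e f) \<longleftrightarrow> well_def b \<rho> e \<and> well_def b \<rho> f \<and> aval b \<rho> f \<noteq> 0"
| "well_def b \<rho> (GF i e) \<longleftrightarrow>
     well_def b \<rho> e \<and> ereal \<bar>aval b \<rho> e\<bar> < fps_conv_radius (gf_deriv b i)"

primrec bval :: "(nat \<Rightarrow> nat) \<Rightarrow> (nat \<Rightarrow> real) \<Rightarrow> bexp \<Rightarrow> bool" where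
  "bval b \<rho> (Lt e f) \<longleftrightarrow> aval b \<rho> e < aval b \<rho> f"
| "bval b \<rho> (Neg c) \<longleftrightarrow> \<not> bval b \<rho> c"
| "bval b \<rho> (Conj c d) \<longleftrightarrow> bval b \<rho> c \<and> bval b \<rho> d"

text \<open>\<open>cells\<close> is one more than the largest array address written so far.\<close>

record state =
  regs :: "nat \<Rightarrow> real"
  mem :: "nat \<Rightarrow> real"
  steps :: nat
  cells :: nat

definition tick :: "nat \<Rightarrow> state \<Rightarrow> state" where
  "tick c s = s\<lparr>steps := steps s + c\<rparr>"

definition set_reg :: "nat \<Rightarrow> real \<Rightarrow> state \<Rightarrow> state" where
  "set_reg v x s = s\<lparr>regs := (regs s)(v := x)\<rparr>"

definition set_mem :: "nat \<Rightarrow> real \<Rightarrow> state \<Rightarrow> state" where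
  "set_mem a x s = s\<lparr>mem := (mem s)(a := x), cells := max (cells s) (Suc a)\<rparr>"

definition is_root :: "(nat \<Rightarrow> nat) \<Rightarrow> (nat \<Rightarrow> real) \<Rightarrow> nat \<Rightarrow> aexp \<Rightarrow> real \<Rightarrow> bool" where
  "is_root b \<rho> v f t \<longleftrightarrow> well_def b (\<rho>(v := t)) f \<and> aval b (\<rho>(v := t)) f = 0"

partial_function (spmf) while_spmf ::
  "('a \<Rightarrow> bool) \<Rightarrow> ('a \<Rightarrow> 'a) \<Rightarrow> ('a \<Rightarrow> 'a spmf) \<Rightarrow> 'a \<Rightarrow> 'a spmf" where
  "while_spmf test t body s =
     (if test s then bind_spmf (body (t s)) (while_spmf test t body) else return_spmf (t s))"

text \<open>
  The missing mass of \<open>exec b c s\<close> is the probability of divergence or of a run-time error: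
  an array address that is not a natural number, a distribution parameter outside its range, or
  a root search without a root.

  \<open>Geometric\<close> and \<open>Bernoulli\<close> take time proportional to the sampled value (plus one).
  \<open>FindRoot v f l u\<close> puts into register \<open>v\<close> a root, strictly between \<open>l\<close> and \<open>u\<close>, of \<open>f\<close>
  as a function of register \<open>v\<close>, the other registers being parameters.
\<close>

primrec exec :: "(nat \<Rightarrow> nat) \<Rightarrow> com \<Rightarrow> state \<Rightarrow> state spmf" where
  "exec b Skip s = return_spmf s"
| "exec b (Assign v e) s = return_spmf (tick 1 (set_reg v (aval b (regs s) e) s))"
| "exec b (Load v e) s =
     (let a = aval b (regs s) e in
      if a \<in> \<nat> then return_spmf (tick 1 (set_reg v (mem s (nat \<lfloor>a\<rfloor>)) s)) else return_pmf None)"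
| "exec b (Store e f) s =
     (let a = aval b (regs s) e in
      if a \<in> \<nat> then return_spmf (tick 1 (set_mem (nat \<lfloor>a\<rfloor>) (aval b (regs s) f) s))
      else return_pmf None)"
| "exec b (Geometric v e) s =
     (let p = aval b (regs s) e in
      if 0 < p \<and> p \<le> 1
      then map_spmf (\<lambda>x. tick (1 + x) (set_reg v (real x) s)) (spmf_of_pmf (geometric_pmf p))
      else return_pmf None)"
| "exec b (Bernoulli v e) s =
     (let p = aval b (regs s) e in
      if 0 \<le> p \<and> p \<le> 1
      then map_spmf (\<lambda>x. tick (1 + of_bool x) (set_reg v (of_bool x) s))
             (spmf_of_pmf (bernoulli_pmf p))
      else return_pmf None)"
| "exec b (FindRoot v f l u) s =
     (let R = {t. aval b (regs s) l < t \<and> t < aval b (regs s) u \<and> is_root b (regs s) v f t} in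
      if R \<noteq> {} then return_spmf (tick 1 (set_reg v (SOME t. t \<in> R) s)) else return_pmf None)"
| "exec b (Seq c d) s = bind_spmf (exec b c s) (exec b d)"
| "exec b (Cond t c d) s =
     (if bval b (regs s) t then exec b c (tick 1 s) else exec b d (tick 1 s))"
| "exec b (While t c) s = while_spmf (\<lambda>s. bval b (regs s) t) (tick 1) (exec b c) s"

text \<open>The input is passed in register 0; everything else is initially zero.\<close>

definition init_state :: "nat \<Rightarrow> state" where
  "init_state n = \<lparr>regs = (\<lambda>_. 0)(0 := real n), mem = (\<lambda>_. 0), steps = 0, cells = 0\<rparr>"

definition run :: "(nat \<Rightarrow> nat) \<Rightarrow> com \<Rightarrow> nat \<Rightarrow> state spmf" where
  "run b c n = exec b c (init_state n)"

text \<open>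
  A final state represents a multiset of summands as follows: register 0 holds the number of
  summands, and cells \<open>2 * i\<close> and \<open>2 * i + 1\<close> hold the size and the type of the \<open>i\<close>-th one.
\<close>

definition decode :: "state \<Rightarrow> (nat \<times> nat) multiset option" where
  "decode s =
     (if regs s 0 \<in> \<nat> \<and> (\<forall>a < 2 * nat \<lfloor>regs s 0\<rfloor>. mem s a \<in> \<nat>)
      then Some (mset (map (\<lambda>i. (nat \<lfloor>mem s (2 * i)\<rfloor>, nat \<lfloor>mem s (2 * i + 1)\<rfloor>))
                           [0..<nat \<lfloor>regs s 0\<rfloor>]))
      else None)"

definition output_dist :: "(nat \<Rightarrow> nat) \<Rightarrow> com \<Rightarrow> nat \<Rightarrow> (nat \<times> nat) multiset spmf" where
  "output_dist b c n = bind_spmf (run b c n) (\<lambda>s. return_pmf (decode s))"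

text \<open>Divergence and run-time errors count as infinite running time.\<close>

definition expected_time :: "(nat \<Rightarrow> nat) \<Rightarrow> com \<Rightarrow> nat \<Rightarrow> ennreal" where
  "expected_time b c n =
     (\<integral>\<^sup>+ x. (case x of None \<Rightarrow> \<infinity> | Some s \<Rightarrow> of_nat (steps s)) \<partial>measure_pmf (run b c n))"

definition space_bounded :: "(nat \<Rightarrow> nat) \<Rightarrow> com \<Rightarrow> nat \<Rightarrow> real \<Rightarrow> bool" where
  "space_bounded b c n S \<longleftrightarrow> (\<forall>s \<in> set_spmf (run b c n). real (cells s) \<le> S)"

end

theory Submission
  imports Defs
begin

text \<open>
  Let \<open>c n\<close> be the number of weighted partitions of \<open>n\<close>, and let \<open>\<sigma> j\<close> be the sum of \<open>d * b d\<close> over the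
  divisors \<open>d\<close> of \<open>j\<close>. Marking one unit of size in a partition and counting twice gives
  \<open>n * c n = (\<Sum>j=1..n. \<sigma> j * c (n - j))\<close>, and the same double count shows that the following step
  of Nijenhuis and Wilf is uniform: choose \<open>j\<close> with weight \<open>\<sigma> j * c (n - j)\<close>, a divisor \<open>d\<close> of \<open>j\<close>
  with weight \<open>d * b d\<close> and a type uniformly, emit \<open>j div d\<close> summands of size \<open>d\<close>, and continue with
  \<open>n - j\<close>. Given tables of \<open>c\<close> and \<open>\<sigma>\<close>, a step costs \<open>O(j + b d)\<close> when all choices are made by
  sequential Bernoulli trials, hence \<open>O(n ^ (r + 1))\<close> in total, surely and not only on average.

  The tables are read off the evaluation oracle: for the counting series \<open>f\<close> and a huge integer \<open>B\<close>,
  the numbers \<open>c k\<close> are the digits in base \<open>B\<close> of \<open>f (1 / B)\<close>, and the numbers \<open>\<sigma> k\<close> are those of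
  \<open>x * f' x / f x\<close> at \<open>x = 1 / B\<close>. A digit is isolated by doubling and halving, in time proportional
  to its bit length, which is \<open>O(sqrt n)\<close> for \<open>r = 0\<close> and \<open>O(n)\<close> otherwise. So the tables cost
  \<open>O(n powr (3 / 2))\<close> and \<open>O(n ^ 2)\<close>, respectively, which is within the claimed bound.
\<close>

section \<open>Counting weighted partitions\<close>

abbreviation num_wp :: "(nat \<Rightarrow> nat) \<Rightarrow> nat \<Rightarrow> nat" where
  "num_wp b n \<equiv> card (weighted_partitions b n)"

text \<open>These are the coefficients of \<open>x * f' x / f x\<close> for the counting series
  \<open>f\<close>, which is how they are computed later.\<close>

definition div_weight :: "(nat \<Rightarrow> nat) \<Rightarrow> nat \<Rightarrow> nat" where
  "div_weight b j = (\<Sum>d | d dvd j. d * b d)"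

lemma sum_mset_image_eq_sum_count:
  "(\<Sum>x\<in>#M. f x) = (\<Sum>x\<in>set_mset M. count M x * f x :: nat)"
proof (induction M)
  case (add x M)
  show ?case
  proof (cases "x \<in># M")
    case True
    thus ?thesis using add
      by (auto simp: insert_absorb sum.remove[of "set_mset M" x] algebra_simps intro!: sum.cong split: if_splits)
  next
    case False
    have "(\<Sum>y\<in>set_mset M. count (add_mset x M) y * f y) = (\<Sum>y\<in>set_mset M. count M y * f y)"
      using False by (intro sum.cong) auto
    thus ?thesis using add False by (simp add: not_in_iff)
  qed
qed simp

lemma weighted_partitions_0: "weighted_partitions b 0 = {{#}}"
proof -
  have "P = {#}" if P: "P \<in> weighted_partitions b 0" for P
  proof (rule ccontr)
    assume "P \<noteq> {#}"
    then obtain x where x: "x \<in># P" by blast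
    obtain k j where [simp]: "x = (k, j)" by force
    from x P have "1 \<le> k" by (auto simp: weighted_partitions_def)
    with P x show False by (auto simp: weighted_partitions_def case_prod_unfold)
  qed
  thus ?thesis by (auto simp: weighted_partitions_def)
qed

lemma weighted_partitions_nonempty:
  assumes "0 < b 1"
  shows "weighted_partitions b n \<noteq> {}"
proof -
  have "replicate_mset n (1, 1) \<in> weighted_partitions b n"
    using assms by (auto simp: weighted_partitions_def)
  thus ?thesis by blast
qed

lemma num_wp_pos: "0 < b 1 \<Longrightarrow> 0 < num_wp b n"
  using weighted_partitions_nonempty finite_weighted_partitions by (simp add: card_gt_0_iff)

section \<open>Double counting of contained blocks\<close>

lemma weighted_partition_count_le:
  assumes "P \<in> weighted_partitions b n"
  shows "k * count P (k, j) \<le> n"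
proof -
  have "replicate_mset (count P (k, j)) (k, j) \<subseteq># P"
    by (simp add: count_le_replicate_mset_subset_eq[symmetric])
  then obtain Q where Q: "P = replicate_mset (count P (k, j)) (k, j) + Q"
    by (meson mset_subset_eq_exists_conv)
  have "n = (\<Sum>(k, j) \<in># P. k)"
    using assms by (simp add: weighted_partitions_def)
  also have "\<dots> = count P (k, j) * k + (\<Sum>(k, j) \<in># Q. k)"
    by (subst Q) simp
  finally show ?thesis by (simp add: mult.commute)
qed

text \<open>Deleting the block is a bijection whose inverse adds it back; the bounds on
  \<open>t\<close> keep the enlarged multiset legal.\<close>

lemma card_weighted_partitions_containing:
  assumes "1 \<le> d" "1 \<le> t" "t \<le> b d" "d * m \<le> n"
  shows "card {P \<in> weighted_partitions b n. replicate_mset m (d, t) \<subseteq># P} = num_wp b (n - d * m)"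
proof -
  have "bij_betw (\<lambda>Q. Q + replicate_mset m (d, t)) (weighted_partitions b (n - d * m))
          {P \<in> weighted_partitions b n. replicate_mset m (d, t) \<subseteq># P}"
    unfolding bij_betw_def
  proof safe
    fix P assume P: "P \<in> weighted_partitions b n" and "replicate_mset m (d, t) \<subseteq># P"
    then obtain Q where Q: "P = Q + replicate_mset m (d, t)"
      by (metis subset_mset.diff_add)
    hence "Q \<in> weighted_partitions b (n - d * m)"
      using P by (auto simp: weighted_partitions_def algebra_simps)
    with Q show "P \<in> (\<lambda>Q. Q + replicate_mset m (d, t)) ` weighted_partitions b (n - d * m)"
      by blast
  qed (use assms in \<open>auto simp: weighted_partitions_def inj_on_def algebra_simps split: if_splits\<close>)
  thus ?thesis by (simp add: bij_betw_same_card)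
qed

text \<open>A block contained in \<open>P\<close> is a summand \<open>(d, t)\<close> of
  \<open>P\<close> with a multiplicity \<open>m\<close> from 1 to its count, encoded as
  \<open>(d * m, d, t)\<close>. Each summand contributes \<open>d\<close> once per multiplicity, so
  the total is the size of \<open>P\<close>.\<close>

lemma sum_contained_blocks:
  assumes P: "P \<in> weighted_partitions b n"
  shows "(\<Sum>j=1..n. \<Sum>d | d dvd j. \<Sum>t=1..b d.
            if replicate_mset (j div d) (d, t) \<subseteq># P then d else 0) = n"
proof -
  define f :: "nat \<times> nat \<times> nat \<Rightarrow> bool"
    where "f = (\<lambda>(j, d, t). replicate_mset (j div d) (d, t) \<subseteq># P)"
  define T where "T = (SIGMA j:{1..n}. SIGMA d:{d. d dvd j}. {1..b d})"
  have fin: "finite {d. d dvd j}" if "j \<in> {1..n}" for j :: nat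
    using that by simp
  have finT: "finite T" unfolding T_def by (intro finite_SigmaI fin) auto
  have valid: "1 \<le> k" "1 \<le> t" "t \<le> b k" if "(k, t) \<in># P" for k t
    using P that by (auto simp: weighted_partitions_def)
  have "(\<Sum>j=1..n. \<Sum>d | d dvd j. \<Sum>t=1..b d.
            if replicate_mset (j div d) (d, t) \<subseteq># P then d else 0) =
        (\<Sum>j=1..n. \<Sum>(d, t) \<in> (SIGMA d:{d. d dvd j}. {1..b d}). if f (j, d, t) then d else 0)"
    by (intro sum.cong refl, subst sum.Sigma) (auto simp: f_def fin)
  also have "\<dots> = (\<Sum>(j, d, t) \<in> T. if f (j, d, t) then d else 0)"
    unfolding T_def by (subst sum.Sigma) (auto intro!: finite_SigmaI fin simp: case_prod_unfold)
  also have "\<dots> = (\<Sum>(j, d, t) \<in> {x \<in> T. f x}. d)"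
    by (simp add: sum.inter_filter finT case_prod_unfold)
  also have "\<dots> = (\<Sum>(x, m) \<in> (SIGMA x:set_mset P. {1..count P x}). fst x)"
  proof (rule sum.reindex_bij_witness[where i = "\<lambda>(x, m). (fst x * m, x)"
        and j = "\<lambda>(j, d, t). ((d, t), j div d)"], goal_cases)
    case (2 a)
    obtain j d t where a: "a = (j, d, t)" by (cases a)
    have "d dvd j" "1 \<le> j" "j div d \<le> count P (d, t)"
      using 2 by (auto simp: a T_def f_def count_le_replicate_mset_subset_eq)
    moreover from this have "1 \<le> j div d" by (auto simp: Suc_le_eq elim!: dvdE)
    ultimately show ?case by (auto simp: a simp flip: count_greater_zero_iff)
  next
    case (4 y)
    obtain d t m where y: "y = ((d, t), m)" by (metis prod.exhaust)
    have m: "1 \<le> m" "m \<le> count P (d, t)" "(d, t) \<in># P" using 4 by (auto simp: y)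
    have "d * m \<le> d * count P (d, t)" using m by simp
    also have "\<dots> \<le> n" by (rule weighted_partition_count_le[OF P])
    finally show ?case using m valid[of d t]
      by (auto simp: y T_def f_def count_le_replicate_mset_subset_eq)
  next
    case (3 y)
    thus ?case using valid by (force simp: case_prod_unfold)
  qed (auto simp: T_def)
  also have "\<dots> = (\<Sum>x\<in>set_mset P. count P x * fst x)"
    by (subst sum.Sigma[symmetric]) auto
  also have "\<dots> = (\<Sum>x\<in>#P. fst x)"
    by (simp add: sum_mset_image_eq_sum_count)
  also have "\<dots> = n" using P by (simp add: weighted_partitions_def case_prod_unfold)
  finally show ?thesis .
qed

text \<open>Sum \<open>sum_contained_blocks\<close> over all partitions and count, for each block,
  the partitions that contain it; the \<open>b d\<close> types of a divisor \<open>d\<close> yield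
  the factor \<open>d * b d\<close>.\<close>

theorem num_wp_recurrence:
  "n * num_wp b n = (\<Sum>j=1..n. div_weight b j * num_wp b (n - j))"
proof -
  let ?W = "weighted_partitions b n"
  have "n * num_wp b n = (\<Sum>P\<in>?W. \<Sum>j=1..n. \<Sum>d | d dvd j. \<Sum>t=1..b d.
            if replicate_mset (j div d) (d, t) \<subseteq># P then d else 0)"
    using sum_contained_blocks[of _ b n] by simp
  also have "\<dots> = (\<Sum>j=1..n. \<Sum>d | d dvd j. \<Sum>t=1..b d. \<Sum>P\<in>?W.
            if replicate_mset (j div d) (d, t) \<subseteq># P then d else 0)"
    by (subst sum.swap, rule sum.cong[OF refl], subst sum.swap, rule sum.cong[OF refl],
        subst sum.swap) (rule refl)
  also have "\<dots> = (\<Sum>j=1..n. \<Sum>d | d dvd j. \<Sum>t=1..b d. d * num_wp b (n - j))"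
  proof (intro sum.cong refl)
    fix j d t assume *: "j \<in> {1..n}" "d \<in> {d. d dvd j}" "t \<in> {1..b d}"
    hence "1 \<le> d" by (cases d) auto
    have "(\<Sum>P\<in>?W. if replicate_mset (j div d) (d, t) \<subseteq># P then d else 0) =
            d * card {P \<in> ?W. replicate_mset (j div d) (d, t) \<subseteq># P}"
      by (simp add: sum.inter_filter[symmetric] finite_weighted_partitions)
    thus "(\<Sum>P\<in>?W. if replicate_mset (j div d) (d, t) \<subseteq># P then d else 0) =
            d * num_wp b (n - j)"
      using * \<open>1 \<le> d\<close> by (subst (asm) card_weighted_partitions_containing) auto
  qed
  also have "\<dots> = (\<Sum>j=1..n. div_weight b j * num_wp b (n - j))"
    by (simp add: div_weight_def sum_distrib_right sum_distrib_left mult_ac)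
  finally show ?thesis .
qed

text \<open>Every number divides 0, so the sum is over an infinite set and takes the default value
  0, which is also the constant coefficient of \<open>x * f' x / f x\<close>.\<close>

lemma div_weight_0 [simp]: "div_weight b 0 = 0"
  by (simp add: div_weight_def)

lemma div_weight_pos:
  assumes "0 < b 1" "1 \<le> j"
  shows "0 < div_weight b j"
proof -
  have "0 < 1 * b 1" using assms by simp
  also have "\<dots> \<le> div_weight b j"
    unfolding div_weight_def using assms by (intro member_le_sum) auto
  finally show ?thesis .
qed

text \<open>The term \<open>j = n\<close> of the recurrence is \<open>div_weight b n\<close>, as
  \<open>num_wp b 0 = 1\<close>. This carries growth bounds over from \<open>num_wp\<close> to
  \<open>div_weight\<close>.\<close>

lemma div_weight_le: "div_weight b n \<le> n * num_wp b n"
proof (cases "n = 0")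
  case False
  have "div_weight b n * num_wp b (n - n) \<le> (\<Sum>j=1..n. div_weight b j * num_wp b (n - j))"
    using False by (intro member_le_sum) auto
  thus ?thesis by (simp add: num_wp_recurrence weighted_partitions_0)
qed simp

section \<open>Decomposition of the uniform distribution\<close>

text \<open>Integer weights allow a uniform draw from \<open>w k\<close> tagged copies of every
  \<open>k\<close>, so no normalisation has to be proved. If the total weight is 0, the value is
  unspecified.\<close>

definition weighted_pmf :: "'a set \<Rightarrow> ('a \<Rightarrow> nat) \<Rightarrow> 'a pmf" where
  "weighted_pmf K w = map_pmf fst (pmf_of_set (SIGMA k:K. {..<w k}))"

lemma pmf_weighted_pmf:
  assumes "finite K" "0 < sum w K"
  shows "pmf (weighted_pmf K w) k = (if k \<in> K then real (w k) / real (sum w K) else 0)"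
proof -
  let ?S = "SIGMA k:K. {..<w k}"
  have S: "finite ?S" "card ?S = sum w K" using assms by auto
  hence ne: "?S \<noteq> {}" using assms by (metis card.empty less_numeral_extra(3))
  have "pmf (weighted_pmf K w) k = real (card (?S \<inter> fst -` {k})) / real (sum w K)"
    using S ne by (simp add: weighted_pmf_def pmf_map measure_pmf_of_set del: card_SigmaI)
  also have "?S \<inter> fst -` {k} = (if k \<in> K then {k} \<times> {..<w k} else {})" by auto
  finally show ?thesis by (simp add: card_cartesian_product)
qed

lemma set_weighted_pmf:
  assumes "finite K" "0 < sum w K"
  shows "set_pmf (weighted_pmf K w) = {k \<in> K. 0 < w k}"
  using assms by (auto simp: set_pmf_iff pmf_weighted_pmf simp del: of_nat_sum split: if_splits)

text \<open>Accept \<open>k\<close> with its share, otherwise draw among the rest. Iteration turns a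
  weighted choice into sequential Bernoulli trials, the form that the loops realise.\<close>

lemma weighted_pmf_split:
  assumes "finite K" "k \<in> K" "0 < sum w K"
  shows "weighted_pmf K w = bind_pmf (bernoulli_pmf (real (w k) / real (sum w K)))
           (\<lambda>x. if x then return_pmf k else weighted_pmf (K - {k}) w)"
proof (rule pmf_eqI)
  fix i
  define S S' p where "S = real (sum w K)" and "S' = real (sum w (K - {k}))" and "p = real (w k) / S"
  have S: "S = real (w k) + S'"
    unfolding S_def S'_def using assms by (simp add: sum.remove del: of_nat_sum)
  have pos: "0 < S" "0 \<le> S'" using assms by (simp_all add: S_def S'_def del: of_nat_sum)
  have p: "0 \<le> p" "p \<le> 1" "1 - p = S' / S" using pos S by (auto simp: p_def field_simps)
  have L: "pmf (weighted_pmf K w) i = (if i \<in> K then real (w i) / S else 0)"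
    unfolding S_def by (rule pmf_weighted_pmf[OF assms(1,3)])
  have "pmf (weighted_pmf (K - {k}) w) i * (1 - p) = (if i \<in> K - {k} then real (w i) / S else 0)"
  proof (cases "S' = 0")
    \<comment> \<open>The remaining distribution is unspecified here, but it is multiplied by
      \<open>1 - p = 0\<close>.\<close>
    case True
    hence "\<forall>i\<in>K - {k}. w i = 0" using assms(1) by (simp add: S'_def del: of_nat_sum)
    thus ?thesis using True p by simp
  next
    case False
    hence "0 < sum w (K - {k})" unfolding S'_def by linarith
    hence "pmf (weighted_pmf (K - {k}) w) i = (if i \<in> K - {k} then real (w i) / S' else 0)"
      unfolding S'_def using assms(1) by (intro pmf_weighted_pmf finite_Diff)
    thus ?thesis using False p by simp
  qed
  moreover have "pmf (bind_pmf (bernoulli_pmf p) (\<lambda>x. if x then return_pmf k else weighted_pmf (K - {k}) w)) i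
      = pmf (return_pmf k) i * p + pmf (weighted_pmf (K - {k}) w) i * (1 - p)"
    using p by (simp add: pmf_bind)
  ultimately have "pmf (bind_pmf (bernoulli_pmf p) (\<lambda>x. if x then return_pmf k else weighted_pmf (K - {k}) w)) i
      = pmf (weighted_pmf K w) i"
    using assms(2) by (auto simp: L p_def indicator_def)
  thus "pmf (weighted_pmf K w) i = pmf (bind_pmf (bernoulli_pmf (real (w k) / real (sum w K)))
           (\<lambda>x. if x then return_pmf k else weighted_pmf (K - {k}) w)) i"
    by (simp add: p_def S_def)
qed

lemma pmf_bind_weighted:
  assumes "finite K" "0 < sum w K"
  shows "pmf (bind_pmf (weighted_pmf K w) f) x =
    (\<Sum>k\<in>K. real (w k) * pmf (f k) x) / real (sum w K)"
proof -
  have "pmf (bind_pmf (weighted_pmf K w) f) x =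
          (\<Sum>k\<in>K. pmf (f k) x * pmf (weighted_pmf K w) k)"
    unfolding pmf_bind using assms
    by (intro integral_measure_pmf_real) (auto simp: set_weighted_pmf)
  thus ?thesis using assms by (simp add: pmf_weighted_pmf sum_divide_distrib mult_ac)
qed

text \<open>For each contained block \<open>(j, d, t)\<close>, the probabilities of
  \<open>j\<close>, \<open>d\<close>, \<open>t\<close> and the remainder multiply to
  \<open>d / (n * num_wp b n)\<close>: all intermediate weights cancel. By
  \<open>sum_contained_blocks\<close> these products add up to
  \<open>1 / num_wp b n\<close>.\<close>

theorem uniform_weighted_partition_decomp:
  assumes b: "\<And>k. 1 \<le> k \<Longrightarrow> 0 < b k" and n: "1 \<le> n"
  shows "pmf_of_set (weighted_partitions b n) =
    bind_pmf (weighted_pmf {1..n} (\<lambda>j. div_weight b j * num_wp b (n - j))) (\<lambda>j.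
    bind_pmf (weighted_pmf {d. d dvd j} (\<lambda>d. d * b d)) (\<lambda>d.
    bind_pmf (weighted_pmf {1..b d} (\<lambda>_. 1)) (\<lambda>t.
    map_pmf (\<lambda>Q. Q + replicate_mset (j div d) (d, t)) (pmf_of_set (weighted_partitions b (n - j))))))"
    (is "?L = ?R")
proof (rule pmf_eqI)
  fix P
  have b1: "0 < b 1" by (simp add: b)
  let ?W = "weighted_partitions b"
  let ?c = "\<lambda>n. real (num_wp b n)"
  define D where "D = (\<lambda>j. bind_pmf (weighted_pmf {d. d dvd j} (\<lambda>d. d * b d)) (\<lambda>d.
    bind_pmf (weighted_pmf {1..b d} (\<lambda>_. 1)) (\<lambda>t.
    map_pmf (\<lambda>Q. Q + replicate_mset (j div d) (d, t)) (pmf_of_set (?W (n - j))))))"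
  define A where "A = (\<lambda>j d t. if P \<in> ?W n \<and> replicate_mset (j div d) (d, t) \<subseteq># P
                               then 1 else 0 :: real)"
  have inner: "pmf (map_pmf (\<lambda>Q. Q + replicate_mset (j div d) (d, t)) (pmf_of_set (?W (n - j)))) P
      = A j d t / ?c (n - j)"
    if jd: "j \<in> {1..n}" "d dvd j" "t \<in> {1..b d}" for j d t
  proof -
    from jd have d: "1 \<le> d" "d * (j div d) = j" by (auto intro!: Suc_leI Nat.gr0I)
    let ?r = "replicate_mset (j div d) (d, t)"
    \<comment> \<open>Adding a fixed block is injective, so only \<open>P - ?r\<close> can be mapped
      to \<open>P\<close>.\<close>
    have *: "?W (n - j) \<inter> (\<lambda>Q. Q + ?r) -` {P} = (if P \<in> ?W n \<and> ?r \<subseteq># P then {P - ?r} else {})"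
    proof -
      have 1: "Q + ?r \<in> ?W n \<longleftrightarrow> Q \<in> ?W (n - j)" for Q
        using d jd by (auto simp: weighted_partitions_def mult.commute split: if_splits)
      show ?thesis
      proof (cases "?r \<subseteq># P")
        case True
        then obtain Q where "P = Q + ?r" by (metis subset_mset.diff_add)
        thus ?thesis using 1[of Q] by auto
      qed auto
    qed
    show ?thesis
      using weighted_partitions_nonempty[where b = b, OF b1, of "n - j"]
      by (auto simp: pmf_map measure_pmf_of_set finite_weighted_partitions * A_def)
  qed
  have D: "pmf (D j) P = (\<Sum>d | d dvd j. \<Sum>t=1..b d. real d * A j d t) / (real (div_weight b j) * ?c (n - j))"
    if j: "j \<in> {1..n}" for j
  proof -
    have pos: "1 \<le> d" if "d dvd j" for d using that j by (auto intro!: Suc_leI Nat.gr0I)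
    have "pmf (D j) P = (\<Sum>d | d dvd j. real (d * b d) *
       ((\<Sum>t=1..b d. pmf (map_pmf (\<lambda>Q. Q + replicate_mset (j div d) (d, t)) (pmf_of_set (?W (n - j)))) P)
            / real (b d))) / real (div_weight b j)"
      unfolding D_def using j div_weight_pos[where b = b, OF b1, of j] b
      by (subst pmf_bind_weighted) (auto simp: div_weight_def pmf_bind_weighted pos
            intro!: sum.cong arg_cong2[where f = "(/)"])
    also have "\<dots> = (\<Sum>d | d dvd j. real (d * b d) * ((\<Sum>t=1..b d. A j d t / ?c (n - j)) / real (b d)))
                      / real (div_weight b j)"
      using j by (intro arg_cong2[where f = "(/)"] arg_cong2[where f = "(*)"] sum.cong refl inner) auto
    also have "(\<Sum>d | d dvd j. real (d * b d) * ((\<Sum>t=1..b d. A j d t / ?c (n - j)) / real (b d))) =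
       (\<Sum>d | d dvd j. \<Sum>t=1..b d. real d * A j d t / ?c (n - j))"
      using b pos by (intro sum.cong refl) (auto simp: sum_distrib_left[symmetric] sum_divide_distrib[symmetric] Suc_le_eq)
    finally show ?thesis by (simp add: sum_divide_distrib[symmetric] mult_ac)
  qed
  have pos: "0 < (\<Sum>j=1..n. div_weight b j * num_wp b (n - j))"
  proof -
    have "0 < n * num_wp b n" using n num_wp_pos[of b, OF b1] by simp
    thus ?thesis by (simp only: num_wp_recurrence)
  qed
  have "pmf ?R P = pmf (bind_pmf (weighted_pmf {1..n} (\<lambda>j. div_weight b j * num_wp b (n - j))) D) P"
    by (simp add: D_def)
  also have "\<dots> = (\<Sum>j=1..n. real (div_weight b j * num_wp b (n - j)) * pmf (D j) P) / real (n * num_wp b n)"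
    using pos by (subst pmf_bind_weighted) (auto simp: num_wp_recurrence)
  also have "(\<Sum>j=1..n. real (div_weight b j * num_wp b (n - j)) * pmf (D j) P) =
     (\<Sum>j=1..n. \<Sum>d | d dvd j. \<Sum>t=1..b d. real d * A j d t)"
    using num_wp_pos[of b, OF b1] div_weight_pos[of b, OF b1]
    by (intro sum.cong refl) (auto simp: D Suc_le_eq)
  also have "\<dots> = (if P \<in> ?W n then real n else 0)"
  proof (cases "P \<in> ?W n")
    case True
    have "(\<Sum>j=1..n. \<Sum>d | d dvd j. \<Sum>t=1..b d. real d * A j d t) =
      real (\<Sum>j=1..n. \<Sum>d | d dvd j. \<Sum>t=1..b d. if replicate_mset (j div d) (d, t) \<subseteq># P then d else 0)"
      using True by (auto simp: A_def intro!: sum.cong)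
    thus ?thesis using True by (simp only: sum_contained_blocks[OF True] if_True)
  qed (simp add: A_def)
  also have "\<dots> / real (n * num_wp b n) = pmf ?L P"
    using n weighted_partitions_nonempty[where b = b, OF b1, of n]
    by (simp add: pmf_of_set finite_weighted_partitions indicator_def)
  finally show "pmf ?L P = pmf ?R P" ..
qed

section \<open>Growth of the counting sequence\<close>

lemma pos_int_seq_bound:
  assumes "pos_int_seq_of_degree r b"
  obtains C :: nat where "1 \<le> C" "\<And>k. 1 \<le> k \<Longrightarrow> b k \<le> C * k ^ r"
proof -
  obtain p :: "real poly" where p: "degree p = r" "\<And>k. 1 \<le> k \<Longrightarrow> real (b k) = poly p (real k)"
    using assms by (auto simp: pos_int_seq_of_degree_def)
  define C where "C = nat \<lceil>\<Sum>i\<le>r. \<bar>coeff p i\<bar>\<rceil> + 1"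
  have "b k \<le> C * k ^ r" if "1 \<le> k" for k
  proof -
    have "real (b k) = (\<Sum>i\<le>r. coeff p i * real k ^ i)"
      using p that by (simp add: poly_altdef)
    also have "\<dots> \<le> (\<Sum>i\<le>r. \<bar>coeff p i\<bar> * real k ^ r)"
      using that by (intro sum_mono mult_mono power_increasing) auto
    also have "\<dots> = (\<Sum>i\<le>r. \<bar>coeff p i\<bar>) * real k ^ r"
      by (simp add: sum_distrib_right)
    also have "\<dots> \<le> real C * real k ^ r"
      unfolding C_def by (rule mult_right_mono) (linarith, simp)
    finally show ?thesis by (simp flip: of_nat_power of_nat_mult)
  qed
  thus ?thesis by (intro that[of C]) (auto simp: C_def)
qed

text \<open>Real coefficients cannot be program constants. In
  \<open>p x = (x - a) * q x + p a\<close> the value \<open>p a\<close> is rational and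
  \<open>q\<close> is rational at the naturals beyond \<open>a\<close>; repeating this gives a
  Newton form whose constants are quotients of integers.\<close>

lemma rational_poly_aexp:
  fixes p :: "real poly"
  assumes "degree p \<le> r" "\<And>k. a \<le> k \<Longrightarrow> poly p (real k) \<in> \<rat>"
  shows "\<exists>e. \<forall>b \<rho>. aval b \<rho> e = poly p (\<rho> v)"
  using assms
proof (induction r arbitrary: p a)
  case 0
  then obtain c where c: "p = [:c:]" using degree_eq_zeroE by blast
  hence "c \<in> \<rat>" using 0(2)[of a] by simp
  then obtain x y where "c = of_int x / of_int y" by (rule Rats_cases') auto
  thus ?case by (intro exI[of _ "Divide (Const x) (Const y)"]) (simp add: c)
next
  case (Suc r)
  define q where "q = synthetic_div p (real a)"
  have p: "poly p x = (x - real a) * poly q x + poly p (real a)" for x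
    using arg_cong[OF synthetic_div_correct'[of "real a" p], of "\<lambda>p. poly p x"]
    by (simp add: q_def algebra_simps)
  have "poly p (real a) \<in> \<rat>" using Suc.prems by simp
  then obtain x y where xy: "poly p (real a) = of_int x / of_int y" by (rule Rats_cases') auto
  \<comment> \<open>The base point moves to \<open>Suc a\<close> because the division by
    \<open>k - a\<close> excludes \<open>k = a\<close>.\<close>
  have "poly q (real k) \<in> \<rat>" if "Suc a \<le> k" for k
  proof -
    have "poly q (real k) = (poly p (real k) - poly p (real a)) / (real k - real a)"
      using that by (simp add: p[of "real k"])
    also have "\<dots> \<in> \<rat>" using Suc.prems(2)[of a] Suc.prems(2)[of k] that by auto
    finally show ?thesis .
  qed
  moreover have "degree q \<le> r" using Suc.prems(1) by (simp add: q_def degree_synthetic_div)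
  ultimately obtain e where e: "\<forall>b \<rho>. aval b \<rho> e = poly q (\<rho> v)"
    using Suc.IH by blast
  show ?case
    by (intro exI[of _ "Plus (Times (Minus (Reg v) (Const (int a))) e) (Divide (Const x) (Const y))"])
      (simp add: e xy p[of "_ v"])
qed

lemma pos_int_seq_aexp:
  assumes "pos_int_seq_of_degree r b"
  obtains e where "\<And>\<rho> k. \<rho> v = real k \<Longrightarrow> 1 \<le> k \<Longrightarrow> aval b \<rho> e = real (b k)"
proof -
  obtain p :: "real poly" where p: "degree p = r" "\<And>k. 1 \<le> k \<Longrightarrow> real (b k) = poly p (real k)"
    using assms by (auto simp: pos_int_seq_of_degree_def)
  have "poly p (real k) \<in> \<rat>" if "1 \<le> k" for k
    using p(2)[OF that] by (metis Rats_of_nat)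
  then obtain e where "\<forall>b \<rho>. aval b \<rho> e = poly p (\<rho> v)"
    using rational_poly_aexp[of p r 1] p(1) by blast
  thus ?thesis using p by (intro that[of e]) auto
qed

text \<open>A polynomial bound on \<open>div_weight b j\<close> is below \<open>M ^ j\<close>;
  inserted into the recurrence together with \<open>(2 * M) ^ (n - j)\<close>, it leaves powers of 2
  that sum to at most \<open>2 ^ n\<close>.\<close>

lemma num_wp_exponential_bound:
  assumes "\<And>k. 1 \<le> k \<Longrightarrow> b k \<le> C * k ^ r" "1 \<le> C"
  shows "\<exists>K::nat. \<forall>n. num_wp b n \<le> K ^ n"
proof -
  \<comment> \<open>By \<open>j < 2 ^ j\<close>, the bound \<open>C * j ^ (r + 2)\<close> is at most
    \<open>C ^ j * (2 ^ j) ^ (r + 2) = M ^ j\<close>.\<close>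
  define M where "M = C * 2 ^ (r + 2)"
  have sig: "div_weight b j \<le> M ^ j" if j: "1 \<le> j" for j
  proof -
    have "div_weight b j \<le> (\<Sum>d | d dvd j. j * (C * j ^ r))"
      unfolding div_weight_def
    proof (rule sum_mono)
      fix d assume "d \<in> {d. d dvd j}"
      hence d: "1 \<le> d" "d \<le> j" using j by (auto intro!: Suc_leI Nat.gr0I dvd_imp_le)
      have "b d \<le> C * d ^ r" using assms d by simp
      also have "\<dots> \<le> C * j ^ r" using d by (simp add: power_mono)
      finally show "d * b d \<le> j * (C * j ^ r)" using d by (intro mult_mono) auto
    qed
    also have "\<dots> = card {d. d dvd j} * (j * (C * j ^ r))" by simp
    also have "\<dots> \<le> j * (j * (C * j ^ r))"
    proof -
      have "{d. d dvd j} \<subseteq> {1..j}" using j by (auto intro!: Suc_leI Nat.gr0I dvd_imp_le)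
      hence "card {d. d dvd j} \<le> card {1..j}" by (intro card_mono) auto
      thus ?thesis by simp
    qed
    also have "\<dots> = C * j ^ (r + 2)" by (simp add: power_add power2_eq_square)
    also have "\<dots> \<le> C ^ j * (2 ^ j) ^ (r + 2)"
      using j assms(2) less_exp[of j] by (intro mult_mono power_mono self_le_power) auto
    also have "\<dots> = M ^ j" by (simp add: M_def power_mult_distrib power_mult[symmetric] mult.commute del: power_add power_Suc add_2_eq_Suc')
    finally show ?thesis .
  qed
  have "num_wp b n \<le> (2 * M) ^ n" for n
  proof (induction n rule: less_induct)
    case (less n)
    show ?case
    proof (cases "n = 0")
      case False
      have "n * num_wp b n \<le> (\<Sum>j=1..n. M ^ j * (2 * M) ^ (n - j))"
        unfolding num_wp_recurrence using False
        by (intro sum_mono mult_mono sig less.IH) auto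
      also have "\<dots> = (\<Sum>j=1..n. 2 ^ (n - j) * M ^ n)"
        by (intro sum.cong refl) (simp add: power_mult_distrib flip: power_add)
      also have "\<dots> = (\<Sum>i<n. 2 ^ i) * M ^ n"
        unfolding sum_distrib_right
        by (rule sum.reindex_bij_witness[where i = "\<lambda>i. n - i" and j = "\<lambda>j. n - j"]) auto
      also have "(\<Sum>i<n. 2 ^ i) \<le> (2::nat) ^ n"
        by (induction n) auto
      hence "(\<Sum>i<n. 2 ^ i) * M ^ n \<le> (2 * M) ^ n"
        by (simp add: power_mult_distrib)
      also have "\<dots> \<le> n * (2 * M) ^ n" using False by simp
      finally show ?thesis using False by simp
    qed (simp add: weighted_partitions_0)
  qed
  thus ?thesis by blast
qed

section \<open>The bound \<open>exp (O(sqrt n))\<close> for bounded sequences\<close>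

lemma sum_inverse_squares_le: "(\<Sum>m=1..n. 1 / real m ^ 2) \<le> 2"
proof -
  \<comment> \<open>The term \<open>1 / n\<close> makes the induction telescope; for
    \<open>n = 0\<close> it is 0 by the convention on division.\<close>
  have "(\<Sum>m=1..n. 1 / real m ^ 2) \<le> 2 - 1 / real n"
  proof (induction n)
    case (Suc n)
    show ?case
    proof (cases "n = 0")
      case False
      hence "1 / (real n + 1)\<^sup>2 \<le> 1 / (real n * (real n + 1))"
        by (intro divide_left_mono) (auto simp: power2_eq_square)
      also have "\<dots> = 1 / real n - 1 / (real n + 1)" using False by (simp add: field_simps)
      finally show ?thesis using Suc by (simp add: add.commute)
    qed simp
  qed simp
  thus ?thesis by (smt (verit) divide_nonneg_nonneg of_nat_0_le_iff)
qed

text \<open>With \<open>y = exp (- t)\<close> the full series is \<open>y / (1 - y) ^ 2\<close>; its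
  double pole at \<open>t = 0\<close> explains the shape of the bound.\<close>

lemma exp_geometric_deriv_le:
  fixes t :: real
  assumes "0 < t"
  shows "(\<Sum>d=1..n. real d * exp (- t) ^ d) \<le> 2 / t\<^sup>2"
proof -
  define y where "y = exp (- t)"
  have y: "0 < y" "y < 1" using assms by (auto simp: y_def)
  have "(\<Sum>d=1..n. real d * y ^ d) = y * (\<Sum>d<n. real (Suc d) * y ^ d)"
    unfolding sum_distrib_left
    by (rule sum.reindex_bij_witness[where i = Suc and j = "\<lambda>d. d - 1"])
      (auto simp: power_Suc[symmetric] simp del: power_Suc)
  also have "(\<Sum>d<n. real (Suc d) * y ^ d) \<le> (\<Sum>d. real (Suc d) * y ^ d)"
    using geometric_deriv_sums[of y] y by (intro sum_le_suminf) (auto simp: sums_iff)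
  also have "\<dots> = 1 / (1 - y)\<^sup>2"
    using geometric_deriv_sums[of y] y by (simp add: sums_iff)
  finally have *: "(\<Sum>d=1..n. real d * y ^ d) \<le> y / (1 - y)\<^sup>2" using y by simp
  \<comment> \<open>\<open>exp t \<ge> 1 + t\<close> bounds \<open>1 - y\<close> from below at the
    price of a factor \<open>1 + t\<close>, which the quadratic Taylor bound absorbs
    afterwards.\<close>
  have "y * (1 + t) \<le> 1"
    using exp_ge_add_one_self[of t] by (simp add: y_def exp_minus field_simps)
  hence "t \<le> (1 + t) * (1 - y)" by (simp add: algebra_simps)
  hence "t\<^sup>2 \<le> ((1 + t) * (1 - y))\<^sup>2" using assms by (intro power_mono) auto
  hence "y * t\<^sup>2 \<le> (y * (1 + t)\<^sup>2) * (1 - y)\<^sup>2" using y by (simp add: power_mult_distrib)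
  also have "y * (1 + t)\<^sup>2 \<le> 2"
  proof -
    have "1 + t + t\<^sup>2 / 2 \<le> exp t" using assms exp_lower_Taylor_quadratic[of t] by simp
    hence "(1 + t)\<^sup>2 \<le> 2 * exp t" by (simp add: power2_eq_square algebra_simps)
    thus ?thesis by (simp add: y_def exp_minus field_simps)
  qed
  hence "y * (1 + t)\<^sup>2 * (1 - y)\<^sup>2 \<le> 2 * (1 - y)\<^sup>2" by (rule mult_right_mono) simp
  finally have "y / (1 - y)\<^sup>2 \<le> 2 / t\<^sup>2" using y assms by (simp add: field_simps)
  with * show ?thesis by (simp add: y_def)
qed

text \<open>Erdos's induction: in the recurrence, \<open>sqrt (n - j) \<le> sqrt n - j / (2 * sqrt n)\<close> turns the bound
  for \<open>n - j\<close> into a geometric weight \<open>exp (- x) ^ j\<close>.\<close>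

lemma num_wp_sqrt_bound:
  fixes C :: nat
  assumes b: "\<And>k. 1 \<le> k \<Longrightarrow> b k \<le> C" and C: "1 \<le> C"
  shows "real (num_wp b n) \<le> exp (4 * real C * sqrt (real n))"
proof (induction n rule: less_induct)
  case (less n)
  \<comment> \<open>The value that closes the induction: with \<open>x = A / (2 * sqrt n)\<close>
    the estimate \<open>4 * C / x ^ 2\<close> reached below equals \<open>n / C\<close>, which is at
    most \<open>n\<close>.\<close>
  define A where "A = 4 * real C"
  have A: "0 < A" using C by (simp add: A_def)
  show ?case
  proof (cases "n = 0")
    case False
    hence n: "0 < real n" by simp
    define x where "x = A / (2 * sqrt (real n))"
    have x: "0 < x" using A n by (simp add: x_def)
    have step: "exp (A * sqrt (real (n - j))) \<le> exp (A * sqrt (real n)) * exp (- x) ^ j"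
      if j: "j \<in> {1..n}" for j
    proof -
      have *: "sqrt (real (n - j)) \<le> sqrt (real n) - real j / (2 * sqrt (real n))"
      proof (rule real_le_lsqrt)
        have "real j / (2 * sqrt (real n)) \<le> real n / (2 * sqrt (real n))"
          using j by (intro divide_right_mono) auto
        also have "\<dots> = sqrt (real n) / 2" using n by (simp add: real_div_sqrt)
        also have "\<dots> \<le> sqrt (real n)" by simp
        finally show "0 \<le> sqrt (real n) - real j / (2 * sqrt (real n))" by simp
        have "(sqrt (real n) - real j / (2 * sqrt (real n)))\<^sup>2 =
                real n - real j + (real j / (2 * sqrt (real n)))\<^sup>2"
          using n by (simp add: power2_diff)
        thus "real (n - j) \<le> (sqrt (real n) - real j / (2 * sqrt (real n)))\<^sup>2"
          using j by (simp add: of_nat_diff)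
      qed
      have "A * sqrt (real (n - j)) \<le> A * (sqrt (real n) - real j / (2 * sqrt (real n)))"
        using A by (intro mult_left_mono[OF *]) simp
      also have "\<dots> = A * sqrt (real n) - real j * x" by (simp add: x_def algebra_simps)
      finally show ?thesis by (simp add: exp_add[symmetric] flip: exp_of_nat_mult)
    qed
    have "real (n * num_wp b n) = (\<Sum>j=1..n. real (div_weight b j) * real (num_wp b (n - j)))"
      unfolding num_wp_recurrence by simp
    also have "\<dots> \<le> (\<Sum>j=1..n. real (div_weight b j) * (exp (A * sqrt (real n)) * exp (- x) ^ j))"
      using less.IH by (intro sum_mono mult_left_mono order.trans[OF _ step]) (auto simp: A_def simp del: of_nat_diff)
    also have "\<dots> = exp (A * sqrt (real n)) * (\<Sum>j=1..n. real (div_weight b j) * exp (- x) ^ j)"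
      by (simp add: sum_distrib_left mult_ac)
    also have "(\<Sum>j=1..n. real (div_weight b j) * exp (- x) ^ j) \<le> real n"
    proof -
      \<comment> \<open>\<open>g (m, d)\<close> bounds the term with \<open>j = d * m\<close>, since
        \<open>exp (- x) ^ j = exp (- (m * x)) ^ d\<close>. The pairs \<open>(m, d)\<close> are then
        enlarged to a square, so that the sum over \<open>d\<close> can be bounded first.\<close>
      define g where "g = (\<lambda>(m, d). real C * (real d * exp (- (real m * x)) ^ d))"
      let ?S = "SIGMA j:{1..n}. {d. d dvd j}"
      have S: "1 \<le> d" "d \<le> n" "d * (j div d) = j" "1 \<le> j div d" "j div d \<le> n"
        if "(j, d) \<in> ?S" for j d
      proof -
        have jd: "d dvd j" "1 \<le> j" "j \<le> n" using that by auto
        then obtain m where m: "j = d * m" by blast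
        with jd have dm: "1 \<le> d" "1 \<le> m" by (auto simp: Suc_le_eq)
        have "d * 1 \<le> d * m" "1 * m \<le> d * m" using dm by (intro mult_mono; simp)+
        hence "d \<le> n" "m \<le> n" using jd m by linarith+
        thus "1 \<le> d" "d \<le> n" "d * (j div d) = j" "1 \<le> j div d" "j div d \<le> n"
          using dm m by auto
      qed
      have "(\<Sum>j=1..n. real (div_weight b j) * exp (- x) ^ j) =
              (\<Sum>(j, d)\<in>?S. real d * real (b d) * exp (- x) ^ j)"
        by (subst sum.Sigma[symmetric]) (auto simp: div_weight_def sum_distrib_right)
      also have "\<dots> \<le> (\<Sum>(j, d)\<in>?S. g (j div d, d))"
      proof (rule sum_mono, clarify)
        fix j d assume jd: "j \<in> {1..n}" "d dvd j"
        note S = S[of j d]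
        have "real d * real (b d) * exp (- x) ^ j \<le> real d * real C * exp (- x) ^ j"
          using b[of d] S jd by (intro mult_mono) auto
        moreover have "exp (- x) ^ j = exp (- (real (j div d) * x)) ^ d"
        proof -
          have "real j = real d * real (j div d)" using S jd by (simp flip: of_nat_mult)
          thus ?thesis by (simp flip: exp_of_nat_mult)
        qed
        ultimately show "real d * real (b d) * exp (- x) ^ j \<le> g (j div d, d)"
          by (simp add: g_def mult_ac)
      qed
      also have "\<dots> = (\<Sum>y\<in>(\<lambda>(j, d). (j div d, d)) ` ?S. g y)"
      proof (subst sum.reindex)
        show "inj_on (\<lambda>(j, d). (j div d, d)) ?S"
          by (rule inj_onI, clarify) (metis dvd_mult_div_cancel)
      qed (simp add: case_prod_unfold)
      also have "\<dots> \<le> (\<Sum>y\<in>{1..n} \<times> {1..n}. g y)"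
      proof (rule sum_mono2)
        show "(\<lambda>(j, d). (j div d, d)) ` ?S \<subseteq> {1..n} \<times> {1..n}"
        proof (rule image_subsetI)
          fix u assume u: "u \<in> ?S"
          obtain j d where [simp]: "u = (j, d)" by (cases u)
          show "(case u of (j, d) \<Rightarrow> (j div d, d)) \<in> {1..n} \<times> {1..n}"
            using S[OF u[simplified \<open>u = (j, d)\<close>]] by simp
        qed
      qed (auto simp: g_def)
      also have "\<dots> = (\<Sum>m=1..n. real C * (\<Sum>d=1..n. real d * exp (- (real m * x)) ^ d))"
        by (simp add: sum.cartesian_product[symmetric] g_def sum_distrib_left)
      also have "\<dots> \<le> (\<Sum>m=1..n. real C * (2 / (real m * x)\<^sup>2))"
        using x by (intro sum_mono mult_left_mono exp_geometric_deriv_le) auto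
      also have "\<dots> = 2 * real C / x\<^sup>2 * (\<Sum>m=1..n. 1 / real m ^ 2)"
        by (simp add: sum_distrib_left power_mult_distrib mult_ac)
      also have "\<dots> \<le> 2 * real C / x\<^sup>2 * 2"
        by (intro mult_left_mono sum_inverse_squares_le) auto
      also have "\<dots> = real n / real C"
        using n C by (simp add: x_def A_def power_divide power_mult_distrib field_simps power2_eq_square)
      also have "\<dots> \<le> real n" using n C by (simp add: field_simps)
      finally show ?thesis .
    qed
    hence "exp (A * sqrt (real n)) * (\<Sum>j=1..n. real (div_weight b j) * exp (- x) ^ j)
             \<le> exp (A * sqrt (real n)) * real n" by simp
    finally have "real n * real (num_wp b n) \<le> real n * exp (A * sqrt (real n))" by (simp add: mult_ac)
    thus ?thesis using n by (simp add: A_def)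
  qed (simp add: weighted_partitions_0)
qed

section \<open>Bit lengths of the table entries\<close>

lemma exp_le_two_powr: "0 \<le> x \<Longrightarrow> exp x \<le> 2 powr (2 * x)" for x :: real
proof -
  assume "0 \<le> x"
  moreover have "1 / 2 \<le> ln (2::real)" using ln2_ge_two_thirds by simp
  ultimately have "x * 1 \<le> x * (2 * ln 2)" by (intro mult_left_mono) auto
  thus ?thesis by (simp add: powr_def mult_ac)
qed

lemma exponential_bounds:
  assumes "pos_int_seq_of_degree r b"
  obtains K :: nat where "3 \<le> K" "\<And>k. num_wp b k \<le> K ^ k" "\<And>k. div_weight b k \<le> K ^ k"
proof -
  obtain C where C: "1 \<le> C" "\<And>k. 1 \<le> k \<Longrightarrow> b k \<le> C * k ^ r"
    using pos_int_seq_bound[OF assms] by blast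
  then obtain K where K: "\<And>n. num_wp b n \<le> K ^ n" using num_wp_exponential_bound[of b C r] by blast
  show ?thesis
  \<comment> \<open>The factor 2 absorbs \<open>k < 2 ^ k\<close> in
    \<open>div_weight b k \<le> k * num_wp b k\<close>; the 3 meets the requirement
    \<open>3 \<le> K\<close> of the digit argument.\<close>
  proof (rule that[of "2 * K + 3"])
    fix k
    show "num_wp b k \<le> (2 * K + 3) ^ k"
      by (rule order.trans[OF K]) (auto intro: power_mono)
    have "div_weight b k \<le> k * num_wp b k" by (rule div_weight_le)
    also have "\<dots> \<le> (2 * K) ^ k"
      using mult_mono[OF less_imp_le[OF less_exp[of k]] K[of k]] by (simp add: power_mult_distrib)
    also have "\<dots> \<le> (2 * K + 3) ^ k" by (intro power_mono) auto
    finally show "div_weight b k \<le> (2 * K + 3) ^ k" .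
  qed simp
qed

text \<open>\<open>L n\<close> bounds the bits of the table entries, hence the cost of a digit. For
  \<open>r = 0\<close> the claimed time is only \<open>n powr (7 / 4)\<close>, so a linear bit
  length, costing order \<open>n ^ 2\<close> in total, would be too weak.\<close>

lemma num_wp_bit_length:
  assumes b: "pos_int_seq_of_degree r b"
  obtains L :: "nat \<Rightarrow> nat" and C :: real where
    "\<And>n k. k \<le> n \<Longrightarrow> num_wp b k < 2 ^ L n" "\<And>n k. k \<le> n \<Longrightarrow> div_weight b k < 2 ^ L n"
    "0 \<le> C" "\<And>n. 1 \<le> n \<Longrightarrow> real (L n) \<le> C * real n powr (if r = 0 then 1 / 2 else 1)"
proof (cases "r = 0")
  case False
  obtain K where K: "3 \<le> K" "\<And>k. num_wp b k \<le> K ^ k" "\<And>k. div_weight b k \<le> K ^ k"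
    using exponential_bounds[OF b] by blast
  have lt: "x < 2 ^ (K * n + 1)" if "x \<le> K ^ k" "k \<le> n" for x k n
  proof -
    have "x \<le> K ^ k" by fact
    also have "\<dots> \<le> K ^ n" using that K by (intro power_increasing) auto
    also have "\<dots> \<le> (2 ^ K) ^ n" by (intro power_mono) (auto intro: less_imp_le less_exp)
    also have "\<dots> < 2 ^ (K * n + 1)" by (simp flip: power_mult)
    finally show ?thesis .
  qed
  show ?thesis
  proof (rule that[of "\<lambda>n. K * n + 1" "real K + 1"])
    show "real (K * n + 1) \<le> (real K + 1) * real n powr (if r = 0 then 1 / 2 else 1)"
      if "1 \<le> n" for n using that False by (simp add: algebra_simps)
  qed (use lt[OF K(2)] lt[OF K(3)] in auto)
next
  case True
  obtain C where C: "1 \<le> C" "\<And>k. 1 \<le> k \<Longrightarrow> b k \<le> C" using pos_int_seq_bound[OF b] True by auto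
  \<comment> \<open>The outer 2 is the loss from \<open>exp\<close> to powers of 2;
    \<open>4 * C\<close> comes from \<open>num_wp_sqrt_bound\<close>, and the inner 2 pays for
    \<open>k \<le> exp (2 * sqrt k)\<close> in the bound on \<open>div_weight\<close>.\<close>
  define A where "A = 2 * (4 * real C + 2)"
  define L where "L = (\<lambda>n. nat \<lceil>A * sqrt (real n)\<rceil> + 1)"
  have A: "0 \<le> A" by (simp add: A_def)
  have lt: "x < 2 ^ L n" if "real x \<le> exp ((4 * real C + 2) * sqrt (real k))" "k \<le> n" for x k n
  proof -
    have "real x \<le> exp ((4 * real C + 2) * sqrt (real k))" by fact
    also have "\<dots> \<le> exp ((4 * real C + 2) * sqrt (real n))" using that by (simp add: mult_left_mono)
    also have "\<dots> \<le> 2 powr (2 * ((4 * real C + 2) * sqrt (real n)))"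
      by (intro exp_le_two_powr) auto
    also have "\<dots> < 2 powr real (L n)"
      unfolding L_def A_def by (rule powr_less_mono) linarith+
    also have "\<dots> = real (2 ^ L n)" by (simp add: powr_realpow)
    finally show ?thesis by (simp only: of_nat_less_iff)
  qed
  have c: "real (num_wp b k) \<le> exp (4 * real C * sqrt (real k))" for k
    using C by (intro num_wp_sqrt_bound)
  have c1: "real (num_wp b k) \<le> exp ((4 * real C + 2) * sqrt (real k))" for k
    by (rule order.trans[OF c], subst exp_le_cancel_iff, rule mult_right_mono) auto
  have c2: "real (div_weight b k) \<le> exp ((4 * real C + 2) * sqrt (real k))" for k
  proof -
    have "sqrt (real k) \<le> exp (sqrt (real k))"
      using exp_ge_add_one_self[of "sqrt (real k)"] by linarith
    hence "sqrt (real k) ^ 2 \<le> exp (sqrt (real k)) ^ 2" by (intro power_mono) auto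
    hence "real k \<le> exp (2 * sqrt (real k))" by (simp add: exp_double)
    hence "real k * real (num_wp b k) \<le> exp (2 * sqrt (real k)) * exp (4 * real C * sqrt (real k))"
      by (intro mult_mono c) auto
    moreover have "real (div_weight b k) \<le> real k * real (num_wp b k)"
      using div_weight_le[of b k] by (simp flip: of_nat_mult)
    ultimately show ?thesis by (simp add: algebra_simps flip: exp_add)
  qed
  show ?thesis
  proof (rule that[of L "A + 2"])
    show "real (L n) \<le> (A + 2) * real n powr (if r = 0 then 1 / 2 else 1)" if "1 \<le> n" for n
    proof -
      have "real (L n) \<le> A * sqrt (real n) + 2" using A by (simp add: L_def) linarith
      also have "\<dots> \<le> A * sqrt (real n) + 2 * sqrt (real n)" using that by simp
      finally show ?thesis using True by (simp add: powr_half_sqrt algebra_simps)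
    qed
  qed (use lt[OF c1] lt[OF c2] A in auto)
qed

section \<open>Digits of the generating functions\<close>

text \<open>\<open>y k\<close> is the series with its first \<open>k\<close> digits shifted out. A
  geometric majorant keeps the tail after digit \<open>k \<le> n\<close> below 1, so
  \<open>a k\<close> is the integer part of \<open>y k\<close> and no carries occur.\<close>

lemma digit_expansion:
  fixes a :: "nat \<Rightarrow> nat" and K B :: real
  assumes a: "\<And>k. real (a k) \<le> K ^ k" and K: "3 \<le> K" and B: "B = K ^ (n + 2)"
  defines "y \<equiv> (\<lambda>k. \<Sum>j. real (a (k + j)) * (1 / B) ^ j)"
  shows "y k = real (a k) + y (Suc k) / B" "0 \<le> y k" "k \<le> n \<Longrightarrow> y (Suc k) / B < 1"
proof -
  \<comment> \<open>\<open>3 * K \<le> B\<close> makes the ratio \<open>K / B\<close> at most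
    \<open>1 / 3\<close>, so the geometric factor is at most \<open>3 / 2\<close>, which is less
    than \<open>K\<close>.\<close>
  have "K * 3 \<le> K * K" using K by (intro mult_left_mono) auto
  also have "K * K \<le> K ^ n * (K * K)" using K by (simp add: one_le_power)
  finally have KB: "K * 3 \<le> B" by (simp add: B mult_ac)
  hence Bpos: "0 < B" and q: "0 < K / B" "K / B \<le> 1 / 3" "\<bar>K / B\<bar> < 1"
    using K by (auto simp: field_simps)
  have le: "real (a (k + j)) * (1 / B) ^ j \<le> K ^ k * (K / B) ^ j" for k j
    using mult_right_mono[OF a[of "k + j"], of "(1 / B) ^ j"] Bpos
    by (simp add: power_add power_divide)
  have sg: "summable (\<lambda>j. K ^ k * (K / B) ^ j)" for k
    using q(3) by (intro summable_mult summable_geometric) (simp only: real_norm_def)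
  have sm: "summable (\<lambda>j. real (a (k + j)) * (1 / B) ^ j)" for k
    by (rule summable_comparison_test'[OF sg[of k], of 0]) (use le Bpos in auto)
  show "y k = real (a k) + y (Suc k) / B"
    unfolding y_def using suminf_split_head[OF sm[of k]] suminf_divide[OF sm[of "Suc k"], of B]
    by (simp add: mult_ac)
  show "0 \<le> y k" unfolding y_def using Bpos by (intro suminf_nonneg sm) auto
  show "y (Suc k) / B < 1" if "k \<le> n"
  proof -
    have "y (Suc k) \<le> (\<Sum>j. K ^ Suc k * (K / B) ^ j)"
      unfolding y_def by (intro suminf_le le sm sg)
    also have "\<dots> = K ^ Suc k * (1 / (1 - K / B))"
      using q(3) by (simp only: suminf_mult suminf_geometric summable_geometric real_norm_def)
    also have "\<dots> \<le> K ^ Suc n * (3 / 2)"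
    proof (intro mult_mono power_increasing)
      have "1 / (1 - K / B) \<le> 1 / (2 / 3)" using q by (intro divide_left_mono) auto
      thus "1 / (1 - K / B) \<le> 3 / 2" by simp
      show "0 \<le> 1 / (1 - K / B)" using q by (simp only: zero_le_divide_1_iff)
    qed (use K that in auto)
    also have "\<dots> < K ^ Suc n * K" using K by (intro mult_strict_left_mono) auto
    also have "\<dots> = B" by (simp add: B)
    finally show ?thesis using Bpos by simp
  qed
qed

text \<open>The oracle returns 0 outside the open disc, so \<open>1 / B\<close> must be strictly
  inside. Comparison with \<open>(1 / 2) ^ k\<close> gives convergence at the larger point
  \<open>1 / (2 * K)\<close>.\<close>

lemma fps_conv_radius_exponential_coeffs:
  fixes a :: "nat \<Rightarrow> nat" and K B :: real
  assumes a: "\<And>k. real (a k) \<le> K ^ k" and K: "3 \<le> K" and B: "B = K ^ (n + 2)"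
  shows "ereal \<bar>1 / B\<bar> < fps_conv_radius (Abs_fps (\<lambda>k. real (a k)))"
proof -
  have "summable (\<lambda>k. real (a k) * (1 / (2 * K)) ^ k)"
  proof (rule summable_comparison_test'[of "\<lambda>k. (1 / 2) ^ k" 0])
    fix k
    show "norm (real (a k) * (1 / (2 * K)) ^ k) \<le> (1 / 2) ^ k"
      using a[of k] K by (simp add: power_divide power_mult_distrib field_simps)
  qed (simp add: summable_geometric)
  hence "ereal (norm (1 / (2 * K))) \<le> conv_radius (\<lambda>k. real (a k))"
    by (intro conv_radius_geI)
  moreover have "2 * K < B"
  proof -
    have "2 * K < K * K" using K by simp
    also have "K * K \<le> K ^ n * (K * K)" using K by (simp add: one_le_power)
    finally show ?thesis by (simp add: B mult_ac)
  qed
  hence "ereal \<bar>1 / B\<bar> < ereal (norm (1 / (2 * K)))" using K by (simp add: field_simps)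
  ultimately show ?thesis unfolding fps_conv_radius_def fps_nth_Abs_fps by (rule less_le_trans[rotated])
qed

section \<open>The logarithmic derivative of the counting series\<close>

lemma gf_deriv_simps: "gf_deriv b 0 = counting_gf b" "gf_deriv b (Suc 0) = fps_deriv (counting_gf b)"
  by (simp_all add: gf_deriv_def)

text \<open>This is \<open>num_wp_recurrence\<close> read as an identity of coefficients.\<close>

lemma div_weight_gf: "Abs_fps (\<lambda>k. real (div_weight b k)) * counting_gf b = fps_X * fps_deriv (counting_gf b)"
proof (rule fps_ext)
  fix n
  have "fps_nth (Abs_fps (\<lambda>k. real (div_weight b k)) * counting_gf b) n =
          (\<Sum>j=0..n. real (div_weight b j * num_wp b (n - j)))"
    by (simp add: fps_mult_nth counting_gf_def)
  also have "\<dots> = real (\<Sum>j=1..n. div_weight b j * num_wp b (n - j))"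
    by (simp add: sum.atLeast_Suc_atMost)
  also have "\<dots> = fps_nth (fps_X * fps_deriv (counting_gf b)) n"
    unfolding num_wp_recurrence[symmetric] by (cases n) (simp_all add: counting_gf_def algebra_simps)
  finally show "fps_nth (Abs_fps (\<lambda>k. real (div_weight b k)) * counting_gf b) n =
    fps_nth (fps_X * fps_deriv (counting_gf b)) n" .
qed

text \<open>Makes the \<open>div_weight\<close> series, which has no oracle of its own, available
  through the oracles for the counting series and its derivative.\<close>

lemma eval_div_weight_gf:
  assumes "ereal \<bar>x\<bar> < fps_conv_radius (counting_gf b)"
    "ereal \<bar>x\<bar> < fps_conv_radius (Abs_fps (\<lambda>k. real (div_weight b k)))"
    "eval_fps (counting_gf b) x \<noteq> 0"
  shows "x * eval_fps (fps_deriv (counting_gf b)) x / eval_fps (counting_gf b) x =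
           (\<Sum>k. real (div_weight b k) * x ^ k)"
proof -
  have "eval_fps (Abs_fps (\<lambda>k. real (div_weight b k))) x * eval_fps (counting_gf b) x =
      eval_fps (fps_X * fps_deriv (counting_gf b)) x"
    using assms by (subst eval_fps_mult[symmetric]) (auto simp: div_weight_gf)
  also have "\<dots> = x * eval_fps (fps_deriv (counting_gf b)) x"
    using assms(1) fps_conv_radius_deriv[of "counting_gf b"]
    by (subst eval_fps_mult) (auto simp: eval_fps_X intro: less_le_trans)
  finally show ?thesis using assms(3) by (simp add: field_simps eval_fps_def)
qed

section \<open>Reasoning about programs by coupling\<close>

notation Seq (infixr ";;" 60)

text \<open>\<open>D\<close> has full mass, so the coupling also rules out divergence and run-time errors.\<close>

definition samples :: "(nat \<Rightarrow> nat) \<Rightarrow> com \<Rightarrow> state \<Rightarrow> 'a pmf \<Rightarrow> (state \<Rightarrow> 'a \<Rightarrow> bool) \<Rightarrow> bool" where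
  "samples b c s D Q \<longleftrightarrow> rel_pmf (\<lambda>r x. \<exists>s'. r = Some s' \<and> Q s' x) (exec b c s) D"

text \<open>Coupling with a one-point distribution says that every outcome satisfies
  \<open>Q\<close>; deterministic fragments thus share the rules for sampling.\<close>

abbreviation computes :: "(nat \<Rightarrow> nat) \<Rightarrow> com \<Rightarrow> state \<Rightarrow> (state \<Rightarrow> bool) \<Rightarrow> bool" where
  "computes b c s Q \<equiv> samples b c s (return_pmf ()) (\<lambda>s' _. Q s')"

lemma state_simps [simp]:
  "regs (tick c s) = regs s" "mem (tick c s) = mem s" "cells (tick c s) = cells s"
  "steps (tick c s) = steps s + c"
  "regs (set_reg v x s) = (regs s)(v := x)" "mem (set_reg v x s) = mem s"
  "cells (set_reg v x s) = cells s" "steps (set_reg v x s) = steps s"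
  "regs (set_mem a x s) = regs s" "mem (set_mem a x s) = (mem s)(a := x)"
  "cells (set_mem a x s) = max (cells s) (Suc a)" "steps (set_mem a x s) = steps s"
  by (simp_all add: tick_def set_reg_def set_mem_def)

lemma samples_mono:
  assumes "samples b c s D Q" "\<And>s' x. x \<in> set_pmf D \<Longrightarrow> Q s' x \<Longrightarrow> Q' s' x"
  shows "samples b c s D Q'"
  using assms(1) unfolding samples_def by (rule pmf.rel_mono_strong) (use assms(2) in blast)

lemma samples_map:
  assumes "samples b c s D Q" "\<And>s' x. x \<in> set_pmf D \<Longrightarrow> Q s' x \<Longrightarrow> Q' s' (f x)"
  shows "samples b c s (map_pmf f D) Q'"
  unfolding samples_def pmf.rel_map
  using assms(1) unfolding samples_def by (rule pmf.rel_mono_strong) (use assms(2) in blast)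

text \<open>Couplings compose; the first one is strengthened by membership in the support of
  \<open>D\<close>, so that the continuation only meets values that can occur.\<close>

lemma rel_pmf_bind_spmf:
  assumes "rel_pmf (\<lambda>r x. \<exists>s'. r = Some s' \<and> R s' x) p D"
    "\<And>s' x. x \<in> set_pmf D \<Longrightarrow> R s' x \<Longrightarrow> rel_pmf P (f s') (E x)"
  shows "rel_pmf P (bind_spmf p f) (bind_pmf D E)"
  unfolding bind_spmf_def
proof (rule rel_pmf_bindI)
  show "rel_pmf (\<lambda>r x. x \<in> set_pmf D \<and> (\<exists>s'. r = Some s' \<and> R s' x)) p D"
    using assms(1) by (rule pmf.rel_mono_strong) auto
qed (use assms(2) in auto)

lemma samples_Seq:
  assumes "samples b c s D R" "\<And>s' x. x \<in> set_pmf D \<Longrightarrow> R s' x \<Longrightarrow> samples b d s' (E x) Q"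
  shows "samples b (Seq c d) s (bind_pmf D E) Q"
  using assms unfolding samples_def by (auto intro: rel_pmf_bind_spmf)

lemma samples_bind_Seq:
  assumes "samples b c s D R" "\<And>s' x. x \<in> set_pmf D \<Longrightarrow> R s' x \<Longrightarrow> samples b d s' (E x) Q"
    "D' = bind_pmf D E"
  shows "samples b (c;; d) s D' Q"
  using samples_Seq[OF assms(1,2)] assms(3) by simp

lemma computes_Seq:
  assumes "computes b c s R" "\<And>s'. R s' \<Longrightarrow> samples b d s' D Q"
  shows "samples b (Seq c d) s D Q"
  using samples_Seq[of b c s "return_pmf ()" "\<lambda>s' _. R s'" d "\<lambda>_. D" Q] assms
  by (simp add: bind_return_pmf)

lemma samples_While_stop:
  assumes "\<not> bval b (regs s) t" "Q (tick 1 s) x"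
  shows "samples b (While t c) s (return_pmf x) Q"
  using assms by (simp add: samples_def while_spmf.simps)

lemma samples_While_step:
  assumes "bval b (regs s) t" "samples b c (tick 1 s) D R"
    "\<And>s' x. x \<in> set_pmf D \<Longrightarrow> R s' x \<Longrightarrow> samples b (While t c) s' (E x) Q"
  shows "samples b (While t c) s (bind_pmf D E) Q"
proof -
  have "exec b (While t c) s = bind_spmf (exec b c (tick 1 s)) (exec b (While t c))"
    using assms(1) by (simp add: while_spmf.simps[of _ _ _ s] cong: bind_spmf_cong)
  thus ?thesis using assms(2,3) unfolding samples_def by (auto intro: rel_pmf_bind_spmf)
qed

text \<open>The index of \<open>I\<close> bounds the number of remaining rounds: each round needs a
  predecessor, so the test must fail at 0 and termination is part of the rule.\<close>

lemma computes_While: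
  assumes "I k s"
    "\<And>k s. I k s \<Longrightarrow> bval b (regs s) t \<Longrightarrow> \<exists>i. k = Suc i \<and> computes b c (tick 1 s) (I i)"
    "\<And>k s. I k s \<Longrightarrow> \<not> bval b (regs s) t \<Longrightarrow> Q (tick 1 s)"
  shows "computes b (While t c) s Q"
  using assms(1)
proof (induction k arbitrary: s)
  case 0
  thus ?case using assms(2)[of 0 s] assms(3) by (intro samples_While_stop) auto
next
  case (Suc k)
  show ?case
  proof (cases "bval b (regs s) t")
    case True
    have "samples b (While t c) s (bind_pmf (return_pmf ()) (\<lambda>_. return_pmf ())) (\<lambda>s' _. Q s')"
      by (rule samples_While_step[where R = "\<lambda>s' _. I k s'"])
         (use True assms(2)[OF Suc.prems True] Suc.IH in auto)
    thus ?thesis by (simp add: bind_return_pmf)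
  next
    case False
    thus ?thesis using assms(3)[OF Suc.prems] by (intro samples_While_stop) auto
  qed
qed

lemma samples_Skip [simp]: "samples b Skip s (return_pmf x) Q \<longleftrightarrow> Q s x"
  by (simp add: samples_def)

lemma samples_Assign [simp]:
  "samples b (Assign v e) s (return_pmf x) Q \<longleftrightarrow> Q (tick 1 (set_reg v (aval b (regs s) e) s)) x"
  by (simp add: samples_def)

lemma samples_Cond [simp]:
  "samples b (Cond t c d) s D Q \<longleftrightarrow>
     (if bval b (regs s) t then samples b c (tick 1 s) D Q else samples b d (tick 1 s) D Q)"
  by (simp add: samples_def)

lemma samples_Assign_Seq [simp]:
  "samples b (Seq (Assign v e) d) s D Q \<longleftrightarrow> samples b d (tick 1 (set_reg v (aval b (regs s) e) s)) D Q"
  by (simp add: samples_def)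

lemma samples_Load_Seq:
  assumes "aval b (regs s) e = real a" "samples b d (tick 1 (set_reg v (mem s a) s)) D Q"
  shows "samples b (Seq (Load v e) d) s D Q"
  using assms by (simp add: samples_def Let_def)

lemma samples_Store_Seq:
  assumes "aval b (regs s) e = real a" "samples b d (tick 1 (set_mem a (aval b (regs s) f) s)) D Q"
  shows "samples b (Seq (Store e f) d) s D Q"
  using assms by (simp add: samples_def Let_def)

lemma samples_Bernoulli:
  assumes "aval b (regs s) e = p" "0 \<le> p" "p \<le> 1"
  shows "samples b (Bernoulli v e) s (bernoulli_pmf p)
           (\<lambda>s' x. s' = tick (1 + of_bool x) (set_reg v (of_bool x) s))"
  using assms by (simp add: samples_def Let_def map_spmf_conv_bind_spmf spmf_of_pmf_def
      map_pmf_comp bind_spmf_def bind_map_pmf o_def pmf.rel_map map_pmf_def[symmetric] rel_pmf_reflI)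

lemma samples_Bernoulli_Seq:
  assumes "aval b (regs s) e = p" "0 \<le> p" "p \<le> 1"
    "\<And>x. samples b d (tick (1 + of_bool x) (set_reg v (of_bool x) s)) (return_pmf x) Q"
  shows "samples b (Bernoulli v e;; d) s (bernoulli_pmf p) Q"
proof -
  have "samples b (Bernoulli v e;; d) s (bind_pmf (bernoulli_pmf p) return_pmf) Q"
    using assms(4) by (intro samples_Seq[OF samples_Bernoulli[OF assms(1-3)]]) auto
  thus ?thesis by (simp add: bind_return_pmf')
qed

text \<open>Loop form of \<open>weighted_pmf_split\<close>: one round tries \<open>k\<close>, a hit
  leaves the loop, and a miss continues with the other candidates.\<close>

lemma samples_While_select:
  assumes K: "finite K" "k \<in> K" "0 < sum w K"
    and t: "bval b (regs s) t"
    and c: "samples b c (tick 1 s) (bernoulli_pmf (real (w k) / real (sum w K))) R"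
    and hit: "\<And>s'. R s' True \<Longrightarrow> \<not> bval b (regs s') t \<and> Q (tick 1 s') k"
    and miss: "\<And>s'. R s' False \<Longrightarrow> 0 < sum w (K - {k}) \<Longrightarrow>
                 samples b (While t c) s' (weighted_pmf (K - {k}) w) Q"
  shows "samples b (While t c) s (weighted_pmf K w) Q"
  unfolding weighted_pmf_split[OF K]
proof (rule samples_While_step[OF t c])
  fix s' x assume x: "x \<in> set_pmf (bernoulli_pmf (real (w k) / real (sum w K)))" and R: "R s' x"
  show "samples b (While t c) s' (if x then return_pmf k else weighted_pmf (K - {k}) w) Q"
  proof (cases x)
    case True
    thus ?thesis using hit R by (auto intro: samples_While_stop)
  next
    case False
    \<comment> \<open>If no weight remained, the trial would succeed with probability 1, and a miss
      could not lie in its support.\<close>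
    have "sum w (K - {k}) \<noteq> 0"
    proof
      assume "sum w (K - {k}) = 0"
      hence "sum w K = w k" using K by (simp add: sum.remove[of K k] del: sum_eq_0_iff)
      hence "real (w k) / real (sum w K) = 1" using K by simp
      moreover have "pmf (bernoulli_pmf 1) False = 0" by simp
      ultimately show False using x False by (simp add: set_pmf_iff del: of_nat_sum)
    qed
    thus ?thesis using False miss R by simp
  qed
qed

section \<open>Digit extraction\<close>

text \<open>Register 0 holds the input \<open>n\<close> until the last assignment.\<close>

abbreviation (input) "r_base \<equiv> 2 :: nat"
abbreviation (input) "r_val \<equiv> 3 :: nat"
abbreviation (input) "r_idx \<equiv> 4 :: nat"
abbreviation (input) "r_pow \<equiv> 5 :: nat"
abbreviation (input) "r_frac \<equiv> 6 :: nat"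
abbreviation (input) "r_out \<equiv> 7 :: nat"
abbreviation (input) "r_rem \<equiv> 8 :: nat"
abbreviation (input) "r_block \<equiv> 9 :: nat"
abbreviation (input) "r_total \<equiv> 10 :: nat"
abbreviation (input) "r_hit \<equiv> 11 :: nat"
abbreviation (input) "r_weight \<equiv> 12 :: nat"
abbreviation (input) "r_size \<equiv> 13 :: nat"
abbreviation (input) "r_mult \<equiv> 14 :: nat"
abbreviation (input) "r_type \<equiv> 15 :: nat"
abbreviation (input) "r_tmp \<equiv> 16 :: nat"
abbreviation (input) "r_addr \<equiv> 17 :: nat"

definition frame :: "nat set \<Rightarrow> state \<Rightarrow> state \<Rightarrow> bool" where
  "frame V s s' \<longleftrightarrow> (\<forall>v. v \<notin> V \<longrightarrow> regs s' v = regs s v)"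

definition power_loop :: "int \<Rightarrow> com" where
  "power_loop K = While (Lt (Reg r_idx) (Reg 0))
     (Assign r_base (Times (Reg r_base) (Const K));; Assign r_idx (Plus (Reg r_idx) (Const 1)))"

lemma power_loop:
  assumes "regs s 0 = real n" "regs s r_idx = 0"
  shows "computes b (power_loop K) s (\<lambda>s'. regs s' r_base = regs s r_base * of_int K ^ n \<and>
    frame {r_base, r_idx} s s' \<and> mem s' = mem s \<and> cells s' = cells s \<and> steps s' \<le> steps s + 3 * n + 1)"
  unfolding power_loop_def
proof (rule computes_While[where k = n and
    I = "\<lambda>m s'. \<exists>i. i + m = n \<and> regs s' r_idx = real i \<and> regs s' r_base = regs s r_base * of_int K ^ i \<and>
      frame {r_base, r_idx} s s' \<and> mem s' = mem s \<and> cells s' = cells s \<and> steps s' \<le> steps s + 3 * i"],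
    goal_cases)
  case 1
  show ?case using assms by (auto simp: frame_def)
next
  case (2 m s')
  then obtain i where i: "i + m = n" "regs s' r_idx = real i" "regs s' r_base = regs s r_base * of_int K ^ i"
      "frame {r_base, r_idx} s s'" "mem s' = mem s" "cells s' = cells s" "steps s' \<le> steps s + 3 * i"
      "regs s' r_idx < regs s' 0"
    by auto
  hence "i < n" using assms by (simp add: frame_def)
  hence "m = Suc (m - 1)" "Suc i + (m - 1) = n" using i by auto
  thus ?case using i by (intro exI[of _ "m - 1"] conjI) (auto simp: frame_def intro!: exI[of _ "Suc i"])
next
  case (3 m s')
  then obtain i where i: "i + m = n" "regs s' r_idx = real i" "regs s' r_base = regs s r_base * of_int K ^ i"
      "frame {r_base, r_idx} s s'" "mem s' = mem s" "cells s' = cells s" "steps s' \<le> steps s + 3 * i"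
      "\<not> regs s' r_idx < regs s' 0"
    by auto
  hence "i = n" using assms by (simp add: frame_def)
  thus ?case using i by (auto simp: frame_def)
qed

text \<open>The starting power of 2 is searched for, because the bit bound \<open>L\<close> is known
  to the analysis only and not to the program.\<close>

definition double_loop :: com where
  "double_loop = While (Neg (Lt (Reg r_val) (Reg r_pow))) (Assign r_pow (Times (Reg r_pow) (Const 2)))"

lemma double_loop:
  assumes "regs s r_pow = 1" "regs s r_val < 2 ^ L"
  shows "computes b double_loop s (\<lambda>s'. \<exists>i\<le>L. regs s' = (regs s)(r_pow := 2 ^ i) \<and> regs s r_val < 2 ^ i \<and>
    mem s' = mem s \<and> cells s' = cells s \<and> steps s' \<le> steps s + 2 * L + 1)"
  unfolding double_loop_def
proof (rule computes_While[where k = L and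
    I = "\<lambda>m s'. \<exists>i. i + m = L \<and> regs s' = (regs s)(r_pow := 2 ^ i) \<and>
      mem s' = mem s \<and> cells s' = cells s \<and> steps s' \<le> steps s + 2 * i"], goal_cases)
  case 1
  show ?case using assms by auto
next
  case (2 m s')
  then obtain i where i: "i + m = L" "regs s' = (regs s)(r_pow := 2 ^ i)"
      "mem s' = mem s" "cells s' = cells s" "steps s' \<le> steps s + 2 * i" "\<not> regs s r_val < 2 ^ i"
    by auto
  hence "i \<noteq> L" using assms by auto
  hence "m = Suc (m - 1)" "Suc i + (m - 1) = L" using i by auto
  thus ?case using i by (intro exI[of _ "m - 1"] conjI) (auto intro!: exI[of _ "Suc i"])
next
  case (3 m s')
  then obtain i where i: "i + m = L" "regs s' = (regs s)(r_pow := 2 ^ i)"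
      "mem s' = mem s" "cells s' = cells s" "steps s' \<le> steps s + 2 * i" "regs s r_val < 2 ^ i"
    by auto
  thus ?case by (intro exI[of _ i]) auto
qed

text \<open>Replaces the missing rounding operation: subtracting falling powers of 2 changes
  \<open>r_frac\<close> by integers only and keeps it below \<open>r_pow\<close>, so that the
  fractional part is left.\<close>

definition halve_loop :: com where
  "halve_loop = While (Lt (Const 1) (Reg r_pow)) (Assign r_pow (Divide (Reg r_pow) (Const 2));;
     Cond (Lt (Reg r_frac) (Reg r_pow)) Skip (Assign r_frac (Minus (Reg r_frac) (Reg r_pow))))"

lemma halve_loop:
  assumes "regs s r_pow = 2 ^ i" "0 \<le> regs s r_frac" "regs s r_frac < 2 ^ i"
  shows "computes b halve_loop s (\<lambda>s'. \<exists>v. regs s' = (regs s)(r_pow := 1, r_frac := v) \<and> 0 \<le> v \<and> v < 1 \<and>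
    regs s r_frac - v \<in> \<int> \<and> mem s' = mem s \<and> cells s' = cells s \<and> steps s' \<le> steps s + 4 * i + 1)"
  unfolding halve_loop_def
proof (rule computes_While[where k = i and
    I = "\<lambda>m s'. \<exists>v. regs s' = (regs s)(r_pow := 2 ^ m, r_frac := v) \<and> 0 \<le> v \<and> v < 2 ^ m \<and>
      regs s r_frac - v \<in> \<int> \<and> mem s' = mem s \<and> cells s' = cells s \<and> steps s' + 4 * m \<le> steps s + 4 * i"],
    goal_cases)
  case 1
  show ?case using assms by (intro exI[of _ "regs s r_frac"]) auto
next
  case (2 m s')
  then obtain v where v: "regs s' = (regs s)(r_pow := 2 ^ m, r_frac := v)" "0 \<le> v" "v < 2 ^ m"
      "regs s r_frac - v \<in> \<int>" "mem s' = mem s" "cells s' = cells s" "steps s' + 4 * m \<le> steps s + 4 * i"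
      "(1::real) < 2 ^ m"
    by auto
  then obtain l where l: "m = Suc l" by (cases m) auto
  have "regs s r_frac - (v - 2 ^ l) = (regs s r_frac - v) + of_int (2 ^ l)" by simp
  also have "\<dots> \<in> \<int>" using v by (intro Ints_add) auto
  finally have "regs s r_frac - (v - 2 ^ l) \<in> \<int>" .
  thus ?case using v
    by (auto simp: l fun_upd_twist intro: exI[of _ v] exI[of _ "v - 2 ^ l"])
next
  case (3 m s')
  then obtain v where v: "regs s' = (regs s)(r_pow := 2 ^ m, r_frac := v)" "0 \<le> v" "v < 2 ^ m"
      "regs s r_frac - v \<in> \<int>" "mem s' = mem s" "cells s' = cells s" "steps s' + 4 * m \<le> steps s + 4 * i"
      "\<not> (1::real) < 2 ^ m"
    by auto
  hence "m = 0" using one_less_power[of "2::real" m] by auto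
  thus ?case using v by auto
qed

definition digit_step :: com where
  "digit_step = Assign r_pow (Const 1);; double_loop;; Assign r_frac (Reg r_val);; halve_loop;;
     Store (Plus (Reg r_addr) (Reg r_idx)) (Minus (Reg r_val) (Reg r_frac));;
     Assign r_val (Times (Reg r_frac) (Reg r_base));; Assign r_idx (Plus (Reg r_idx) (Const 1))"

lemma digit_step:
  fixes a k addr :: nat
  assumes s: "regs s r_val = real a + f" "0 \<le> f" "f < 1" "a < 2 ^ L"
    "regs s r_addr = real addr" "regs s r_idx = real k"
  shows "computes b digit_step s (\<lambda>s'. frame {r_val, r_idx, r_pow, r_frac} s s' \<and>
    regs s' r_val = f * regs s r_base \<and> regs s' r_idx = real (Suc k) \<and>
    mem s' = (mem s)(addr + k := real a) \<and> cells s' = max (cells s) (Suc (addr + k)) \<and>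
    steps s' \<le> steps s + 6 * L + 7)"
proof -
  \<comment> \<open>As integers, \<open>a < 2 ^ L\<close> leaves room for the fraction
    \<open>f\<close>.\<close>
  have "real a + 1 \<le> real (2 ^ L)" using s(4) by linarith
  hence lt: "regs s r_val < 2 ^ L" using s by simp
  show ?thesis
    unfolding digit_step_def
  proof (simp only: samples_Assign_Seq, rule computes_Seq[OF double_loop[where L = L]], goal_cases)
    case (3 s1)
    then obtain i where i: "i \<le> L" "regs s1 = (regs s)(r_pow := 2 ^ i)" "regs s r_val < 2 ^ i"
        "mem s1 = mem s" "cells s1 = cells s" "steps s1 \<le> steps s + 2 * L + 2"
      by auto
    show ?case
    proof (simp only: samples_Assign_Seq, rule computes_Seq[OF halve_loop[where i = i]], goal_cases)
      case (4 s2)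
      then obtain v where v: "regs s2 = (regs s)(r_pow := 1, r_frac := v)" "0 \<le> v" "v < 1"
          "regs s r_val - v \<in> \<int>" "mem s2 = mem s" "cells s2 = cells s" "steps s2 \<le> steps s + 6 * L + 4"
        using i by (auto simp: fun_upd_twist)
      \<comment> \<open>\<open>v\<close> and \<open>f\<close> both lie in \<open>[0, 1)\<close> and
        differ by an integer, so they coincide.\<close>
      from v(4) obtain z where z: "real a + f - v = of_int z" by (auto simp: s elim: Ints_cases)
      hence "z = int a" using v s by linarith
      hence "v = f" using z by simp
      show ?case
        by (rule samples_Store_Seq[where a = "addr + k"])
          (use v s \<open>v = f\<close> in \<open>auto simp: frame_def\<close>)
    qed (use i s in auto)
  qed (use lt in auto)
qed

definition extract_digits :: com where
  "extract_digits = Assign r_idx (Const 0);; While (Neg (Lt (Reg 0) (Reg r_idx))) digit_step"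

text \<open>\<open>r_val\<close> is \<open>y i\<close> at round \<open>i\<close>: removing the digit
  leaves \<open>y (Suc i) / B\<close>, and multiplication by \<open>B\<close> brings up the next
  digit. Keeping \<open>a\<close> and \<open>y\<close> abstract serves both tables.\<close>

lemma extract_digits:
  fixes a :: "nat \<Rightarrow> nat" and y :: "nat \<Rightarrow> real"
  assumes s: "regs s 0 = real n" "regs s r_base = B" "regs s r_addr = real addr" "regs s r_val = y 0"
    and y: "\<And>k. k \<le> n \<Longrightarrow> y k = real (a k) + y (Suc k) / B"
      "\<And>k. k \<le> n \<Longrightarrow> 0 \<le> y (Suc k) / B" "\<And>k. k \<le> n \<Longrightarrow> y (Suc k) / B < 1" "B \<noteq> 0"
    and L: "\<And>k. k \<le> n \<Longrightarrow> a k < 2 ^ L"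
  shows "computes b extract_digits s (\<lambda>s'. frame {r_val, r_idx, r_pow, r_frac} s s' \<and>
    mem s' = (\<lambda>x. if addr \<le> x \<and> x \<le> addr + n then real (a (x - addr)) else mem s x) \<and>
    cells s' \<le> max (cells s) (Suc (addr + n)) \<and> steps s' \<le> steps s + (n + 1) * (6 * L + 8) + 2)"
  unfolding extract_digits_def
proof (simp only: samples_Assign_Seq, rule computes_While[where k = "Suc n" and
    I = "\<lambda>m s'. \<exists>i. i + m = Suc n \<and> regs s' r_idx = real i \<and> regs s' r_val = y i \<and>
      frame {r_val, r_idx, r_pow, r_frac} s s' \<and>
      mem s' = (\<lambda>x. if addr \<le> x \<and> x < addr + i then real (a (x - addr)) else mem s x) \<and>
      cells s' \<le> max (cells s) (addr + i) \<and> steps s' \<le> steps s + i * (6 * L + 8) + 1"],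
    goal_cases)
  case 1
  show ?case using s by (auto simp: frame_def fun_eq_iff)
next
  case (2 m s')
  then obtain i where i: "i + m = Suc n" "regs s' r_idx = real i" "regs s' r_val = y i"
      "frame {r_val, r_idx, r_pow, r_frac} s s'"
      "mem s' = (\<lambda>x. if addr \<le> x \<and> x < addr + i then real (a (x - addr)) else mem s x)"
      "cells s' \<le> max (cells s) (addr + i)" "steps s' \<le> steps s + i * (6 * L + 8) + 1"
      "\<not> regs s' 0 < regs s' r_idx"
    by auto
  hence le: "i \<le> n" using s by (simp add: frame_def)
  hence m: "m = Suc (m - 1)" "Suc i + (m - 1) = Suc n" using i by auto
  have "computes b digit_step (tick 1 s') (\<lambda>s''. frame {r_val, r_idx, r_pow, r_frac} (tick 1 s') s'' \<and>
    regs s'' r_val = y (Suc i) / B * regs (tick 1 s') r_base \<and> regs s'' r_idx = real (Suc i) \<and>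
    mem s'' = (mem (tick 1 s'))(addr + i := real (a i)) \<and>
    cells s'' = max (cells (tick 1 s')) (Suc (addr + i)) \<and>
    steps s'' \<le> steps (tick 1 s') + 6 * L + 7)"
    by (rule digit_step) (use i s y(1-3)[OF le] L[OF le] in \<open>auto simp: frame_def\<close>)
  hence "computes b digit_step (tick 1 s') (\<lambda>s'. \<exists>i. i + (m - 1) = Suc n \<and> regs s' r_idx = real i \<and>
      regs s' r_val = y i \<and> frame {r_val, r_idx, r_pow, r_frac} s s' \<and>
      mem s' = (\<lambda>x. if addr \<le> x \<and> x < addr + i then real (a (x - addr)) else mem s x) \<and>
      cells s' \<le> max (cells s) (addr + i) \<and> steps s' \<le> steps s + i * (6 * L + 8) + 1)"
  proof (rule samples_mono, goal_cases)
    case (1 s'' u)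
    have "regs s' r_base = B" using i(4) s by (simp add: frame_def)
    thus ?case
      using 1 i m y(4) by (intro exI[of _ "Suc i"]) (auto simp: frame_def fun_eq_iff)
  qed
  thus ?case using m(1) by blast
next
  case (3 m s')
  then obtain i where i: "i + m = Suc n" "regs s' r_idx = real i" "regs s' r_val = y i"
      "frame {r_val, r_idx, r_pow, r_frac} s s'"
      "mem s' = (\<lambda>x. if addr \<le> x \<and> x < addr + i then real (a (x - addr)) else mem s x)"
      "cells s' \<le> max (cells s) (addr + i)" "steps s' \<le> steps s + i * (6 * L + 8) + 1"
      "regs s' 0 < regs s' r_idx"
    by auto
  hence "i = Suc n" using s by (simp add: frame_def)
  thus ?case using i by (auto simp: frame_def fun_eq_iff)
qed

section \<open>Sampling\<close>

text \<open>The cells below \<open>2 * n\<close> are reserved for the output.\<close>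

definition tables :: "(nat \<Rightarrow> nat) \<Rightarrow> nat \<Rightarrow> (nat \<Rightarrow> real) \<Rightarrow> bool" where
  "tables b n M \<longleftrightarrow>
     (\<forall>k\<le>n. M (2 * n + k) = real (num_wp b k) \<and> M (3 * n + 1 + k) = real (div_weight b k))"

section \<open>Choice of the block size\<close>

definition block_loop :: com where
  "block_loop = While (Lt (Reg r_hit) (Const 1)) (
     Assign r_block (Plus (Reg r_block) (Const 1));;
     Load r_weight (Plus (Plus (Times (Const 3) (Reg 0)) (Const 1)) (Reg r_block));;
     Load r_tmp (Plus (Times (Const 2) (Reg 0)) (Minus (Reg r_rem) (Reg r_block)));;
     Assign r_weight (Times (Reg r_weight) (Reg r_tmp));;
     Bernoulli r_hit (Divide (Reg r_weight) (Reg r_total));;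
     Assign r_total (Minus (Reg r_total) (Reg r_weight)))"

text \<open>\<open>r_total\<close> carries the weight of the candidates not yet tried, so each trial
  has the probability required by \<open>weighted_pmf_split\<close>. The cost is proportional to the
  distance walked, hence to the size that is then removed.\<close>

lemma block_loop:
  fixes N :: nat and b :: "nat \<Rightarrow> nat"
  defines "w \<equiv> (\<lambda>j. div_weight b j * num_wp b (N - j))"
  assumes "regs s 0 = real n" "regs s r_rem = real N" "N \<le> n" "tables b n (mem s)"
    "regs s r_block = real j" "regs s r_hit = 0"
    "regs s r_total = real (sum w {Suc j..N})" "0 < sum w {Suc j..N}"
  shows "samples b block_loop s (weighted_pmf {Suc j..N} w) (\<lambda>s' i. regs s' r_block = real i \<and>
    frame {r_block, r_total, r_hit, r_weight, r_tmp} s s' \<and> mem s' = mem s \<and> cells s' = cells s \<and>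
    steps s' + 8 * j \<le> steps s + 8 * i + 1)"
  using assms(2-)
proof (induction "N - j" arbitrary: j s)
  case 0
  thus ?case by simp
next
  case (Suc m)
  note s = Suc.prems
  let ?V = "{r_block, r_total, r_hit, r_weight, r_tmp}"
  have j: "j < N" using Suc.hyps by simp
  have diff: "{Suc j..N} - {Suc j} = {Suc (Suc j)..N}" by auto
  have sum: "sum w {Suc j..N} = w (Suc j) + sum w {Suc (Suc j)..N}"
    using j by (simp add: sum.atLeast_Suc_atMost)
  have w: "real (w (Suc j)) = real (div_weight b (Suc j)) * real (num_wp b (N - Suc j))"
    by (simp add: w_def)
  have tab: "mem s (3 * n + 1 + Suc j) = real (div_weight b (Suc j))"
    "mem s (2 * n + (N - Suc j)) = real (num_wp b (N - Suc j))"
    using s(3,4) j unfolding tables_def by (metis Suc_leI le_trans, metis diff_le_self le_trans)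
  show ?case
    unfolding block_loop_def
  proof (rule samples_While_select[where k = "Suc j" and R = "\<lambda>s' x. regs s' r_block = real (Suc j) \<and>
        regs s' r_hit = of_bool x \<and> regs s' r_total = real (sum w {Suc (Suc j)..N}) \<and> frame ?V s s' \<and>
        mem s' = mem s \<and> cells s' = cells s \<and> steps s' \<le> steps s + 8"], goal_cases)
    case 5
    show ?case
    proof (simp only: samples_Assign_Seq, rule samples_Load_Seq[where a = "3 * n + 1 + Suc j"], goal_cases)
      case 2
      show ?case
      proof (rule samples_Load_Seq[where a = "2 * n + (N - Suc j)"], goal_cases)
        case 2
        show ?case
        proof (simp only: samples_Assign_Seq, rule samples_Bernoulli_Seq, goal_cases)
          case 1
          show ?case using tab s(1-3,5-8) by (simp add: w del: of_nat_sum add_diff_assoc diff_add_assoc)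
        next
          case 2
          show ?case by (simp del: of_nat_sum)
        next
          case 3
          have "real (w (Suc j)) \<le> real (sum w {Suc j..N})" using sum by linarith
          moreover have "0 < real (sum w {Suc j..N})" using s(8) by (simp only: of_nat_0_less_iff)
          ultimately show ?case by (rule divide_le_eq_1_pos[THEN iffD2, rotated])
        next
          case (4 x)
          have "real (sum w {Suc j..N}) - real (w (Suc j)) = real (sum w {Suc (Suc j)..N})"
            using sum by linarith
          thus ?case using tab s(1-3,5-8) by (simp add: w frame_def del: of_nat_sum)
        qed
      qed (use s j in \<open>simp add: of_nat_diff\<close>)
    qed (use s in simp)
  next
    case (6 s')
    thus ?case by (auto simp: frame_def)
  next
    case (7 s')
    hence "samples b block_loop s' (weighted_pmf {Suc (Suc j)..N} w) (\<lambda>s'' i. regs s'' r_block = real i \<and>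
      frame ?V s' s'' \<and> mem s'' = mem s' \<and> cells s'' = cells s' \<and>
      steps s'' + 8 * Suc j \<le> steps s' + 8 * i + 1)"
      using Suc.hyps(2) s by (intro Suc.hyps(1)) (auto simp: frame_def diff)
    thus ?case unfolding diff block_loop_def[symmetric]
      by (rule samples_mono) (use 7 in \<open>auto simp: frame_def\<close>)
  qed (use s j in auto)
qed

section \<open>Choice of the divisor\<close>

definition divisor_step :: "aexp \<Rightarrow> com" where
  "divisor_step e =
     Cond (Lt (Reg r_block) (Times (Reg r_size) (Reg r_mult)))
       (Assign r_mult (Minus (Reg r_mult) (Const 1)))
       (Cond (Lt (Times (Reg r_size) (Reg r_mult)) (Reg r_block))
         (Assign r_size (Plus (Reg r_size) (Const 1)))
         (Assign r_weight (Times (Reg r_size) e);;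
          Bernoulli r_hit (Divide (Reg r_weight) (Reg r_total));;
          Assign r_total (Minus (Reg r_total) (Reg r_weight));;
          Cond (Lt (Reg r_hit) (Const 1)) (Assign r_size (Plus (Reg r_size) (Const 1))) Skip))"

definition divisor_loop :: "aexp \<Rightarrow> com" where
  "divisor_loop e = While (Lt (Reg r_hit) (Const 1)) (divisor_step e)"

text \<open>The pair \<open>(d, m)\<close> walks along the hyperbola \<open>d * m = j\<close>, so that all divisors \<open>d\<close> of \<open>j\<close> are met,
  together with \<open>j div d\<close>, in \<open>O(j)\<close> steps and without any division with remainder.\<close>

lemma divisor_loop:
  fixes j :: nat and b :: "nat \<Rightarrow> nat"
  defines "w \<equiv> (\<lambda>d. d * b d)"
  assumes e: "\<And>\<rho> k. \<rho> r_size = real k \<Longrightarrow> 1 \<le> k \<Longrightarrow> aval b \<rho> e = real (b k)"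
  assumes "regs s r_block = real j" "1 \<le> j" "regs s r_hit = 0"
    "regs s r_size = real d" "regs s r_mult = real m" "1 \<le> d" "j < d * (m + 1)"
    "regs s r_total = real (sum w {i. i dvd j \<and> d \<le> i})" "0 < sum w {i. i dvd j \<and> d \<le> i}"
  shows "samples b (divisor_loop e) s (weighted_pmf {i. i dvd j \<and> d \<le> i} w) (\<lambda>s' i.
    regs s' r_size = real i \<and> regs s' r_mult = real (j div i) \<and>
    frame {r_size, r_mult, r_total, r_hit, r_weight} s s' \<and> mem s' = mem s \<and> cells s' = cells s \<and>
    steps s' \<le> steps s + 9 * (m + (j + 1 - d)) + 1)"
  using assms(3-)
\<comment> \<open>Every round lowers \<open>m\<close> or raises \<open>d\<close>, unless it ends the
  loop. The invariant \<open>j < d * (m + 1)\<close> says that \<open>m\<close> is not below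
  \<open>j div d\<close>.\<close>
proof (induction "m + (j + 1 - d)" arbitrary: m d s rule: less_induct)
  case less
  note s = less.prems
  let ?V = "{r_size, r_mult, r_total, r_hit, r_weight}"
  let ?K = "\<lambda>d. {i. i dvd j \<and> d \<le> i}"
  have fin: "finite (?K d)" for d using s(2) by simp
  \<comment> \<open>Positive remaining weight means that some divisor from \<open>d\<close> on is
    left; hence \<open>d \<le> j\<close>, and raising \<open>d\<close> really lowers the truncated
    difference.\<close>
  have "?K d \<noteq> {}" using s(9) by force
  then obtain i where "i dvd j" "d \<le> i" by auto
  hence d: "d \<le> j" using s(2) by (meson dvd_imp_le order.trans less_le_trans zero_less_one)
  let ?Q = "\<lambda>s' i. regs s' r_size = real i \<and> regs s' r_mult = real (j div i) \<and>
    frame ?V s s' \<and> mem s' = mem s \<and> cells s' = cells s \<and> steps s' \<le> steps s + 9 * (m + (j + 1 - d)) + 1"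
  have rec: "samples b (divisor_loop e) s' (weighted_pmf (?K d') w) ?Q"
    if "m' + (j + 1 - d') < m + (j + 1 - d)" "regs s' r_hit = 0"
      "regs s' r_size = real d'" "regs s' r_mult = real m'" "1 \<le> d'" "j < d' * (m' + 1)"
      "regs s' r_total = real (sum w (?K d'))" "0 < sum w (?K d')"
      "frame ?V s s'" "mem s' = mem s" "cells s' = cells s" "steps s' \<le> steps s + 9" for s' m' d'
  proof -
    have "samples b (divisor_loop e) s' (weighted_pmf (?K d') w) (\<lambda>s'' i.
      regs s'' r_size = real i \<and> regs s'' r_mult = real (j div i) \<and>
      frame ?V s' s'' \<and> mem s'' = mem s' \<and> cells s'' = cells s' \<and>
      steps s'' \<le> steps s' + 9 * (m' + (j + 1 - d')) + 1)"
      using that s(1,2) by (intro less.hyps) (auto simp: frame_def)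
    thus ?thesis by (rule samples_mono) (use that in \<open>auto simp: frame_def\<close>)
  qed
  have walk: "samples b (divisor_loop e) s (weighted_pmf (?K d) w) ?Q"
    if c: "computes b (divisor_step e) (tick 1 s) (\<lambda>s'. regs s' r_hit = 0 \<and> regs s' r_size = real d' \<and>
        regs s' r_mult = real m' \<and> regs s' r_total = real (sum w (?K d)) \<and> frame ?V s s' \<and> mem s' = mem s \<and>
        cells s' = cells s \<and> steps s' \<le> steps s + 9)"
      and lt: "m' + (j + 1 - d') < m + (j + 1 - d)" "1 \<le> d'" "j < d' * (m' + 1)" "?K d' = ?K d" for m' d'
  proof -
    have "samples b (divisor_loop e) s (bind_pmf (return_pmf ()) (\<lambda>_. weighted_pmf (?K d) w)) ?Q"
      unfolding divisor_loop_def
    proof (rule samples_While_step[OF _ c])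
      fix s' u
      assume "regs s' r_hit = 0 \<and> regs s' r_size = real d' \<and>
        regs s' r_mult = real m' \<and> regs s' r_total = real (sum w (?K d)) \<and> frame ?V s s' \<and> mem s' = mem s \<and>
        cells s' = cells s \<and> steps s' \<le> steps s + 9"
      thus "samples b (While (Lt (Reg r_hit) (Const 1)) (divisor_step e)) s' (weighted_pmf (?K d) w) ?Q"
        using rec[of m' d' s', unfolded lt(4) divisor_loop_def] lt(1-3) s(8,9) by blast
    qed (use s in simp)
    thus ?thesis by (simp add: bind_return_pmf)
  qed
  consider "j < d * m" | "d * m < j" | "d * m = j" by linarith
  thus ?case
  proof cases
    case 1
    hence "real j < real d * real m" by (simp flip: of_nat_mult)
    moreover from 1 have "0 < m" by (cases m) auto
    ultimately show ?thesis using s 1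
      by (intro walk[of d "m - 1"]) (auto simp: divisor_step_def frame_def of_nat_diff)
  next
    case 2
    hence "real d * real m < real j" by (simp flip: of_nat_mult)
    moreover have "\<not> d dvd j"
    proof
      assume "d dvd j"
      then obtain q where q: "j = d * q" by blast
      hence "d * m < d * q" "d * q < d * (m + 1)" using 2 s(7) by simp_all
      hence "m < q" "q < m + 1" by (simp_all only: mult_less_cancel1)
      thus False by simp
    qed
    hence "?K (Suc d) = ?K d" by (auto simp: Suc_le_eq order.order_iff_strict)
    ultimately show ?thesis using s d
      by (intro walk[of "Suc d" m]) (auto simp: divisor_step_def frame_def)
  next
    case 3
    hence eq: "real d * real m = real j" by (simp flip: of_nat_mult)
    have K: "d \<in> ?K d" using 3 by auto
    have diff: "?K d - {d} = ?K (Suc d)" by auto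
    have sum: "sum w (?K d) = w d + sum w (?K (Suc d))"
      using sum.remove[OF fin K, of w] by (simp add: diff)
    have e': "aval b \<rho> e = real (b d)" if "\<rho> r_size = real d" for \<rho>
      using e[of \<rho> d] that s(6) by simp
    show ?thesis
      unfolding divisor_loop_def
    proof (rule samples_While_select[OF fin K s(9), where R = "\<lambda>s' x. regs s' r_hit = of_bool x \<and>
        regs s' r_size = real (if x then d else Suc d) \<and> regs s' r_mult = real m \<and>
        regs s' r_total = real (sum w (?K (Suc d))) \<and> frame ?V s s' \<and> mem s' = mem s \<and>
        cells s' = cells s \<and> steps s' \<le> steps s + 9"], goal_cases)
      case 2
      have p: "0 \<le> real (w d) / real (sum w (?K d))" "real (w d) / real (sum w (?K d)) \<le> 1"
      proof -
        have "real (w d) \<le> real (sum w (?K d))" using sum by linarith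
        moreover have "0 < real (sum w (?K d))" using s(9) by (simp only: of_nat_0_less_iff)
        ultimately show "real (w d) / real (sum w (?K d)) \<le> 1"
          by (rule divide_le_eq_1_pos[THEN iffD2, rotated])
      qed (simp del: of_nat_sum)
      have "samples b (Assign r_weight (Times (Reg r_size) e);;
          Bernoulli r_hit (Divide (Reg r_weight) (Reg r_total));;
          Assign r_total (Minus (Reg r_total) (Reg r_weight));;
          Cond (Lt (Reg r_hit) (Const 1)) (Assign r_size (Plus (Reg r_size) (Const 1))) Skip)
        (tick 1 (tick 1 (tick 1 s))) (bernoulli_pmf (real (w d) / real (sum w (?K d))))
        (\<lambda>s' x. regs s' r_hit = of_bool x \<and>
        regs s' r_size = real (if x then d else Suc d) \<and> regs s' r_mult = real m \<and>
        regs s' r_total = real (sum w (?K (Suc d))) \<and> frame ?V s s' \<and> mem s' = mem s \<and>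
        cells s' = cells s \<and> steps s' \<le> steps s + 9)"
      proof (simp only: samples_Assign_Seq, rule samples_Bernoulli_Seq[OF _ p], goal_cases)
        case 1
        show ?case using s by (simp add: e' w_def del: of_nat_sum)
      next
        case (2 x)
        have "real (sum w (?K d)) - real (w d) = real (sum w (?K (Suc d)))"
          using sum by linarith
        thus ?case using s by (cases x) (auto simp: e' w_def frame_def simp del: of_nat_sum)
      qed
      thus ?case using s(1,4,5) eq by (simp add: divisor_step_def del: of_nat_sum)
    next
      case (3 s')
      have "j div d = m" using \<open>d * m = j\<close> s(6) by auto
      thus ?case using 3 d by (auto simp: frame_def)
    next
      case (4 s')
      have "j < Suc d * (m + 1)" using \<open>d * m = j\<close> by simp
      thus ?case using 4 d unfolding diff divisor_loop_def[symmetric]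
        by (intro rec[of m "Suc d"]) auto
    qed (use s in simp)
  qed
qed

section \<open>Choice of the type\<close>

definition type_loop :: com where
  "type_loop = While (Lt (Reg r_hit) (Const 1)) (
     Assign r_type (Minus (Reg r_type) (Const 1));;
     Bernoulli r_hit (Divide (Const 1) (Reg r_type));; Skip)"

text \<open>Trials with success probabilities \<open>1 / T\<close>, \<open>1 / (T - 1)\<close>, ...,
  \<open>1\<close> give equal chances. The register is decremented before its trial and so starts at
  \<open>Suc T\<close>; the closing \<open>Skip\<close> is the continuation that
  \<open>samples_Bernoulli_Seq\<close> expects.\<close>

lemma type_loop:
  assumes "regs s r_hit = 0" "regs s r_type = real (Suc T)" "1 \<le> T"
  shows "samples b type_loop s (weighted_pmf {1..T} (\<lambda>_. 1)) (\<lambda>s' t. regs s' r_type = real t \<and>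
    frame {r_type, r_hit} s s' \<and> mem s' = mem s \<and> cells s' = cells s \<and> steps s' \<le> steps s + 4 * T + 1)"
  using assms
proof (induction T arbitrary: s)
  case 0
  thus ?case by simp
next
  case (Suc T)
  note s = Suc.prems
  have diff: "{1..Suc T} - {Suc T} = {1..T}" by auto
  show ?case
    unfolding type_loop_def
  proof (rule samples_While_select[where k = "Suc T" and R = "\<lambda>s' x. regs s' r_hit = of_bool x \<and>
      regs s' r_type = real (Suc T) \<and> frame {r_type, r_hit} s s' \<and> mem s' = mem s \<and> cells s' = cells s \<and>
      steps s' \<le> steps s + 4"], goal_cases)
    case 5
    show ?case
      by (simp only: samples_Assign_Seq, rule samples_Bernoulli_Seq)
        (use s in \<open>auto simp: frame_def\<close>)
  next
    case (6 s')
    thus ?case by (auto simp: frame_def)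
  next
    case (7 s')
    hence "samples b type_loop s' (weighted_pmf {1..T} (\<lambda>_. 1)) (\<lambda>s'' t. regs s'' r_type = real t \<and>
      frame {r_type, r_hit} s' s'' \<and> mem s'' = mem s' \<and> cells s'' = cells s' \<and>
      steps s'' \<le> steps s' + 4 * T + 1)"
      by (intro Suc.IH) (auto simp: diff)
    thus ?case unfolding diff type_loop_def[symmetric]
      by (rule samples_mono) (use 7 in \<open>auto simp: frame_def\<close>)
  qed (use s in auto)
qed

text \<open>The reading of memory done by \<open>decode\<close>, with the number of summands as a
  parameter so that it can serve as an invariant.\<close>

definition outputs :: "(nat \<Rightarrow> real) \<Rightarrow> nat \<Rightarrow> (nat \<times> nat) multiset \<Rightarrow> bool" where
  "outputs M q P \<longleftrightarrow> (\<forall>a<2 * q. M a \<in> \<nat>) \<and>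
     mset (map (\<lambda>i. (nat \<lfloor>M (2 * i)\<rfloor>, nat \<lfloor>M (2 * i + 1)\<rfloor>)) [0..<q]) = P"

lemma outputs_Suc:
  assumes "outputs M q P"
  shows "outputs (M(2 * q := real d, Suc (2 * q) := real t)) (Suc q) (add_mset (d, t) P)"
proof -
  let ?M = "M(2 * q := real d, Suc (2 * q) := real t)"
  have "map (\<lambda>i. (nat \<lfloor>?M (2 * i)\<rfloor>, nat \<lfloor>?M (2 * i + 1)\<rfloor>)) [0..<q] =
        map (\<lambda>i. (nat \<lfloor>M (2 * i)\<rfloor>, nat \<lfloor>M (2 * i + 1)\<rfloor>)) [0..<q]"
  proof (rule map_cong)
    fix i assume "i \<in> set [0..<q]"
    hence "2 * i \<noteq> 2 * q" "2 * i \<noteq> Suc (2 * q)" "2 * i + 1 \<noteq> 2 * q" "2 * i + 1 \<noteq> Suc (2 * q)"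
      by auto
    thus "(nat \<lfloor>?M (2 * i)\<rfloor>, nat \<lfloor>?M (2 * i + 1)\<rfloor>) = (nat \<lfloor>M (2 * i)\<rfloor>, nat \<lfloor>M (2 * i + 1)\<rfloor>)"
      by simp
  qed simp
  hence "map (\<lambda>i. (nat \<lfloor>?M (2 * i)\<rfloor>, nat \<lfloor>?M (2 * i + 1)\<rfloor>)) [0..<Suc q] =
        map (\<lambda>i. (nat \<lfloor>M (2 * i)\<rfloor>, nat \<lfloor>M (2 * i + 1)\<rfloor>)) [0..<q] @ [(d, t)]"
    by simp
  moreover have "\<forall>a<2 * Suc q. ?M a \<in> \<nat>" using assms by (auto simp: outputs_def less_Suc_eq)
  ultimately show ?thesis using assms unfolding outputs_def by (simp only: mset_append) simp
qed

definition output_loop :: com where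
  "output_loop = While (Lt (Const 0) (Reg r_mult)) (
     Store (Times (Const 2) (Reg r_out)) (Reg r_size);;
     Store (Plus (Times (Const 2) (Reg r_out)) (Const 1)) (Reg r_type);;
     Assign r_out (Plus (Reg r_out) (Const 1));;
     Assign r_mult (Minus (Reg r_mult) (Const 1)))"

text \<open>The clause on the cells from \<open>2 * (q + m)\<close> on protects the tables, because
  \<open>q + m\<close> does not exceed \<open>n\<close> where the loop is used.\<close>

lemma output_loop:
  assumes s: "regs s r_mult = real m" "regs s r_out = real q" "regs s r_size = real d" "regs s r_type = real t"
    "outputs (mem s) q P"
  shows "computes b output_loop s (\<lambda>s'. regs s' r_out = real (q + m) \<and>
    outputs (mem s') (q + m) (P + replicate_mset m (d, t)) \<and> (\<forall>x\<ge>2 * (q + m). mem s' x = mem s x) \<and>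
    frame {r_mult, r_out} s s' \<and> cells s' \<le> max (cells s) (2 * (q + m)) \<and> steps s' \<le> steps s + 5 * m + 1)"
  unfolding output_loop_def
proof (rule computes_While[where k = m and I = "\<lambda>k s'. \<exists>i. i + k = m \<and> regs s' r_mult = real k \<and>
      regs s' r_out = real (q + i) \<and> outputs (mem s') (q + i) (P + replicate_mset i (d, t)) \<and>
      (\<forall>x\<ge>2 * (q + i). mem s' x = mem s x) \<and> frame {r_mult, r_out} s s' \<and>
      cells s' \<le> max (cells s) (2 * (q + i)) \<and> steps s' \<le> steps s + 5 * i"], goal_cases)
  case 1
  show ?case using s by (auto simp: frame_def)
next
  case (2 k s')
  then obtain i where i: "i + k = m" "regs s' r_mult = real k"
      "regs s' r_out = real (q + i)" "outputs (mem s') (q + i) (P + replicate_mset i (d, t))"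
      "\<And>x. 2 * (q + i) \<le> x \<Longrightarrow> mem s' x = mem s x" "frame {r_mult, r_out} s s'"
      "cells s' \<le> max (cells s) (2 * (q + i))" "steps s' \<le> steps s + 5 * i" "0 < k"
    by auto
  obtain l where l: "k = Suc l" using i by (cases k) auto
  have "computes b (Store (Times (Const 2) (Reg r_out)) (Reg r_size);;
     Store (Plus (Times (Const 2) (Reg r_out)) (Const 1)) (Reg r_type);;
     Assign r_out (Plus (Reg r_out) (Const 1));;
     Assign r_mult (Minus (Reg r_mult) (Const 1))) (tick 1 s') (\<lambda>s'. \<exists>i. i + l = m \<and> regs s' r_mult = real l \<and>
      regs s' r_out = real (q + i) \<and> outputs (mem s') (q + i) (P + replicate_mset i (d, t)) \<and>
      (\<forall>x\<ge>2 * (q + i). mem s' x = mem s x) \<and> frame {r_mult, r_out} s s' \<and>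
      cells s' \<le> max (cells s) (2 * (q + i)) \<and> steps s' \<le> steps s + 5 * i)"
  proof (rule samples_Store_Seq[where a = "2 * (q + i)"], goal_cases)
    case 2
    have d: "regs s' r_size = real d" "regs s' r_type = real t" using i(6) s by (simp_all add: frame_def)
    show ?case
    proof (rule samples_Store_Seq[where a = "Suc (2 * (q + i))"], goal_cases)
      case 2
      show ?case using i outputs_Suc[OF i(4), of d t]
        by (simp add: d l, intro exI[of _ "Suc i"]) (auto simp: frame_def)
    qed (use i in simp)
  qed (use i in simp)
  thus ?case using l by blast
next
  case (3 k s')
  thus ?case by (auto simp: frame_def)
qed

section \<open>One sampling step and its iteration\<close>

definition sample_step :: "aexp \<Rightarrow> com" where
  "sample_step e =
     Assign r_block (Const 0);; Load r_total (Plus (Times (Const 2) (Reg 0)) (Reg r_rem));;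
     Assign r_total (Times (Reg r_rem) (Reg r_total));; Assign r_hit (Const 0);; block_loop;;
     Assign r_size (Const 1);; Assign r_mult (Reg r_block);;
     Load r_total (Plus (Plus (Times (Const 3) (Reg 0)) (Const 1)) (Reg r_block));;
     Assign r_hit (Const 0);; divisor_loop e;;
     Assign r_type (Plus e (Const 1));; Assign r_hit (Const 0);; type_loop;;
     Assign r_rem (Minus (Reg r_rem) (Reg r_block));; output_loop"

definition sample_loop :: "aexp \<Rightarrow> com" where
  "sample_loop e = While (Lt (Const 0) (Reg r_rem)) (sample_step e)"

text \<open>The total weights need no summation: the recurrence gives \<open>N * num_wp b N\<close>
  for the block size, and the second table gives \<open>div_weight b j\<close> for the divisor. A
  cost linear in \<open>j\<close> lets a whole run add up to order \<open>M * n\<close>.\<close>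

lemma sample_step:
  fixes N :: nat
  assumes b: "\<And>k. 1 \<le> k \<Longrightarrow> 0 < b k"
    and e: "\<And>\<rho> k. \<rho> r_size = real k \<Longrightarrow> 1 \<le> k \<Longrightarrow> aval b \<rho> e = real (b k)"
    and M: "\<And>d. 1 \<le> d \<Longrightarrow> d \<le> n \<Longrightarrow> b d \<le> M" "1 \<le> M"
    and s: "regs s 0 = real n" "regs s r_rem = real N" "1 \<le> N" "regs s r_out = real q" "q + N \<le> n"
      "tables b n (mem s)" "outputs (mem s) q P" "cells s \<le> 4 * n + 2"
  shows "samples b (sample_step e) s
    (bind_pmf (weighted_pmf {1..N} (\<lambda>j. div_weight b j * num_wp b (N - j))) (\<lambda>j.
     bind_pmf (weighted_pmf {d. d dvd j} (\<lambda>d. d * b d)) (\<lambda>d.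
     bind_pmf (weighted_pmf {1..b d} (\<lambda>_. 1)) (\<lambda>t. return_pmf (j, d, t)))))
    (\<lambda>s' (j, d, t). \<exists>q'. regs s' 0 = real n \<and> regs s' r_rem = real (N - j) \<and> 1 \<le> j \<and> j \<le> N \<and>
       regs s' r_out = real q' \<and> q' + (N - j) \<le> n \<and> tables b n (mem s') \<and>
       outputs (mem s') q' (P + replicate_mset (j div d) (d, t)) \<and> cells s' \<le> 4 * n + 2 \<and>
       steps s' \<le> steps s + 60 * M * j)"
proof -
  have b1: "0 < b 1" using b by simp
  define w where "w = (\<lambda>j. div_weight b j * num_wp b (N - j))"
  have w: "sum w {1..N} = N * num_wp b N" by (simp add: w_def num_wp_recurrence)
  hence wpos: "0 < sum w {1..N}" using s(3) num_wp_pos[of b N, OF b1] by simp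
  let ?V1 = "{r_block, r_total, r_hit, r_weight, r_tmp}"
  have tabN: "mem s (2 * n + N) = real (num_wp b N)" using s(5,6) by (simp add: tables_def)
  show ?thesis
    unfolding sample_step_def w_def[symmetric]
  proof (simp only: samples_Assign_Seq, rule samples_Load_Seq[where a = "2 * n + N"], goal_cases)
    case 2
    show ?case
    proof (simp only: samples_Assign_Seq,
        rule samples_Seq[OF block_loop[where N = N and j = 0 and n = n and b = b, folded w_def One_nat_def]], goal_cases)
      case (9 s1 j)
      have j: "1 \<le> j" "j \<le> N" using 9(1) wpos by (auto simp: set_weighted_pmf)
      from 9 have s1: "regs s1 r_block = real j" "frame ?V1 s s1" "mem s1 = mem s" "cells s1 = cells s"
          "steps s1 \<le> steps s + 8 * j + 5"
        by (auto simp: frame_def)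
      have tabj: "mem s1 (3 * n + 1 + j) = real (div_weight b j)"
        using s(5,6) j s1(3) by (simp add: tables_def)
      have reg1: "regs s1 0 = real n" "regs s1 r_rem = real N" "regs s1 r_out = real q"
        using s1(2) s by (simp_all add: frame_def)
      \<comment> \<open>As \<open>j\<close> is positive, 0 is not among its divisors, so the walk
        from \<open>d = 1\<close> covers them all.\<close>
      have K: "{i. i dvd j \<and> 1 \<le> i} = {i. i dvd j}" using j by (auto intro!: Suc_leI Nat.gr0I)
      have sum: "(\<Sum>d\<in>{i. i dvd j \<and> 1 \<le> i}. d * b d) = div_weight b j" by (simp only: K div_weight_def)
      have dpos: "0 < (\<Sum>d\<in>{i. i dvd j}. d * b d)"
        using div_weight_pos[of b j, OF b1 j(1)] by (simp only: div_weight_def)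
      show ?case
      proof (simp only: samples_Assign_Seq, rule samples_Load_Seq[where a = "3 * n + 1 + j"], goal_cases)
        case 2
        show ?case
        proof (simp only: samples_Assign_Seq,
            rule samples_bind_Seq[OF divisor_loop[where d = 1 and m = j and j = j, OF e],
              where E = "\<lambda>d. bind_pmf (weighted_pmf {1..b d} (\<lambda>_. 1)) (\<lambda>t. return_pmf (j, d, t))"],
            goal_cases)
          case (12 s2 d)
          have d: "d dvd j" "1 \<le> d" "d \<le> j"
            using 12(1) dpos j unfolding K by (auto simp: set_weighted_pmf dest: dvd_imp_le)
          from 12 have s2: "regs s2 r_size = real d" "regs s2 r_mult = real (j div d)"
              "regs s2 0 = real n" "regs s2 r_rem = real N" "regs s2 r_out = real q"
              "regs s2 r_block = real j" "mem s2 = mem s" "cells s2 = cells s"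
              "steps s2 \<le> steps s + 26 * j + 20"
            using s1 reg1 by (auto simp: frame_def)
          show ?case
          proof (simp only: samples_Assign_Seq,
              rule samples_Seq[OF type_loop[where T = "b d"]], goal_cases)
            case (4 s3 t)
            from 4 have s3: "regs s3 r_type = real t" "regs s3 r_size = real d" "regs s3 r_mult = real (j div d)"
              "regs s3 0 = real n" "regs s3 r_rem = real N" "regs s3 r_out = real q"
              "regs s3 r_block = real j" "mem s3 = mem s" "cells s3 = cells s"
              "steps s3 \<le> steps s + 26 * j + 23 + 4 * b d"
              using s2 by (auto simp: frame_def)
            let ?s = "tick 1 (set_reg r_rem (aval b (regs s3) (Minus (Reg r_rem) (Reg r_block))) s3)"
            have *: "computes b output_loop ?s (\<lambda>s'. regs s' r_out = real (q + j div d) \<and>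
              outputs (mem s') (q + j div d) (P + replicate_mset (j div d) (d, t)) \<and>
              (\<forall>x\<ge>2 * (q + j div d). mem s' x = mem ?s x) \<and> frame {r_mult, r_out} ?s s' \<and>
              cells s' \<le> max (cells ?s) (2 * (q + j div d)) \<and> steps s' \<le> steps ?s + 5 * (j div d) + 1)"
              by (rule output_loop) (use s3 s in auto)
            \<comment> \<open>All choices are made by now; the constant map presents the
              deterministic output as a sample of the chosen triple.\<close>
            have "samples b output_loop ?s (map_pmf (\<lambda>_. (j, d, t)) (return_pmf ()))
              (\<lambda>s' (j, d, t). \<exists>q'. regs s' 0 = real n \<and> regs s' r_rem = real (N - j) \<and> 1 \<le> j \<and> j \<le> N \<and>
               regs s' r_out = real q' \<and> q' + (N - j) \<le> n \<and> tables b n (mem s') \<and>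
               outputs (mem s') q' (P + replicate_mset (j div d) (d, t)) \<and> cells s' \<le> 4 * n + 2 \<and>
               steps s' \<le> steps s + 60 * M * j)"
            proof (rule samples_map[OF *], goal_cases)
              case (1 s' u)
              have le: "j div d \<le> j" by simp
              \<comment> \<open>A block of total size \<open>j\<close> has at most \<open>j\<close>
                summands, so the output stays within its reserved cells.\<close>
              have qn: "q + j div d \<le> n" using le j s(5) by linarith
              have "b d \<le> M" using M(1)[of d] d j s(5) by simp
              \<comment> \<open>Each of \<open>1\<close>, \<open>j\<close> and \<open>M\<close> is
                at most \<open>M * j\<close>, and \<open>26 + 25 + 4 + 5 = 60\<close>.\<close>
              moreover have "26 * j + 25 + 4 * M + 5 * j \<le> 60 * M * j"
              proof -
                have "j \<le> M * j" "M \<le> M * j" "1 \<le> M * j" using M(2) j by auto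
                thus ?thesis unfolding mult.assoc by linarith
              qed
              moreover have "steps s' \<le> steps s3 + 5 * (j div d) + 2" using 1 by simp
              ultimately have "steps s' \<le> steps s + 60 * M * j" using s3(10) le by linarith
              moreover have "tables b n (mem s')"
                using s(6) 1 s3(8) qn unfolding tables_def by simp
              moreover have "q + j div d + (N - j) \<le> n" using le j s(5) by linarith
              ultimately show ?case
                using 1 s3 s j qn by (auto simp: frame_def of_nat_diff intro!: exI[of _ "q + j div d"])
            qed
            thus ?case by simp
          qed (use s2 d b[of d] e[of "regs s2" d] in auto)
        next
          case 13
          show ?case by (simp only: K)
        qed (use s1 tabj j dpos sum K in \<open>auto simp del: of_nat_sum sum_eq_0_iff\<close>)
      qed (use s1 reg1 in auto)
    qed (use s tabN w wpos in \<open>auto simp del: of_nat_sum sum_eq_0_iff\<close>)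
  qed (use s in simp)
qed

lemma sample_loop:
  fixes N :: nat
  assumes b: "\<And>k. 1 \<le> k \<Longrightarrow> 0 < b k"
    and e: "\<And>\<rho> k. \<rho> r_size = real k \<Longrightarrow> 1 \<le> k \<Longrightarrow> aval b \<rho> e = real (b k)"
    and M: "\<And>d. 1 \<le> d \<Longrightarrow> d \<le> n \<Longrightarrow> b d \<le> M" "1 \<le> M"
    and s: "regs s 0 = real n" "regs s r_rem = real N" "regs s r_out = real q" "q + N \<le> n"
      "tables b n (mem s)" "outputs (mem s) q P" "cells s \<le> 4 * n + 2"
  shows "samples b (sample_loop e) s (pmf_of_set (weighted_partitions b N))
    (\<lambda>s' Q. \<exists>q'. regs s' r_out = real q' \<and> outputs (mem s') q' (P + Q) \<and> cells s' \<le> 4 * n + 2 \<and>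
       steps s' \<le> steps s + 61 * M * N + 1)"
  using s
proof (induction N arbitrary: s q P rule: less_induct)
  case (less N)
  note s = less.prems
  show ?case
  proof (cases "N = 0")
    case True
    have "pmf_of_set (weighted_partitions b N) = return_pmf {#}"
      by (simp add: True weighted_partitions_0 pmf_of_set_singleton)
    thus ?thesis using s True by (auto simp: sample_loop_def intro!: samples_While_stop)
  next
    case False
    let ?Q = "\<lambda>s' Q. \<exists>q'. regs s' r_out = real q' \<and> outputs (mem s') q' (P + Q) \<and> cells s' \<le> 4 * n + 2 \<and>
       steps s' \<le> steps s + 61 * M * N + 1"
    have N: "1 \<le> N" using False by simp
    let ?W = "\<lambda>k. pmf_of_set (weighted_partitions b k)"
    let ?E = "\<lambda>(j, d, t). map_pmf (\<lambda>Q. Q + replicate_mset (j div d) (d, t)) (?W (N - j))"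
    let ?D = "bind_pmf (weighted_pmf {1..N} (\<lambda>j. div_weight b j * num_wp b (N - j))) (\<lambda>j.
     bind_pmf (weighted_pmf {d. d dvd j} (\<lambda>d. d * b d)) (\<lambda>d.
     bind_pmf (weighted_pmf {1..b d} (\<lambda>_. 1)) (\<lambda>t. return_pmf (j, d, t))))"
    \<comment> \<open>The step samples the triple only; the remainder comes from the induction
      hypothesis, and \<open>?E\<close> adds the block to it.\<close>
    have eq: "?W N = bind_pmf ?D ?E"
      by (subst uniform_weighted_partition_decomp[OF b N])
        (simp_all add: bind_assoc_pmf bind_return_pmf)
    have step: "samples b (sample_step e) (tick 1 s) ?D
      (\<lambda>s' (j, d, t). \<exists>q'. regs s' 0 = real n \<and> regs s' r_rem = real (N - j) \<and> 1 \<le> j \<and> j \<le> N \<and>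
         regs s' r_out = real q' \<and> q' + (N - j) \<le> n \<and> tables b n (mem s') \<and>
         outputs (mem s') q' (P + replicate_mset (j div d) (d, t)) \<and> cells s' \<le> 4 * n + 2 \<and>
         steps s' \<le> steps (tick 1 s) + 60 * M * j)"
      by (rule sample_step) (use b e M s N in auto)
    show ?thesis
      unfolding eq sample_loop_def
    proof (rule samples_While_step[OF _ step], goal_cases)
      case 1
      show ?case using s N by simp
    next
      case (2 s' x)
      obtain j d t where x: "x = (j, d, t)" by (cases x)
      from 2 obtain q' where s': "regs s' 0 = real n" "regs s' r_rem = real (N - j)" "1 \<le> j" "j \<le> N"
          "regs s' r_out = real q'" "q' + (N - j) \<le> n" "tables b n (mem s')"
          "outputs (mem s') q' (P + replicate_mset (j div d) (d, t))" "cells s' \<le> 4 * n + 2"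
          "steps s' \<le> steps s + 1 + 60 * M * j"
        by (auto simp: x)
      have "samples b (sample_loop e) s' (?W (N - j)) (\<lambda>s'' Q. \<exists>q'. regs s'' r_out = real q' \<and>
          outputs (mem s'') q' (P + replicate_mset (j div d) (d, t) + Q) \<and> cells s'' \<le> 4 * n + 2 \<and>
          steps s'' \<le> steps s' + 61 * M * (N - j) + 1)"
        by (rule less.IH) (use s' in auto)
      thus ?case unfolding x prod.case sample_loop_def[symmetric]
      proof (rule samples_map, goal_cases)
        case (1 s'' Q)
        \<comment> \<open>The loop test of a round is paid by one further \<open>M * j\<close>,
          hence 61.\<close>
        have "1 + 60 * M * j + 61 * M * (N - j) \<le> 61 * M * N"
        proof -
          have "1 \<le> M * j" using M(2) s'(3) by simp
          moreover have "M * N = M * j + M * (N - j)" using s'(4) by (simp flip: distrib_left)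
          ultimately show ?thesis unfolding mult.assoc by linarith
        qed
        thus ?case using 1 s'(10) by (fastforce simp: add_ac)
      qed
    qed
  qed
qed

text \<open>Starting from \<open>K * K\<close>, the power loop ends with the base
  \<open>K ^ (n + 2)\<close> of \<open>digit_expansion\<close>. The table of \<open>num_wp\<close>
  starts at cell \<open>2 * n\<close>, that of \<open>div_weight\<close> at
  \<open>3 * n + 1\<close>.\<close>

definition sampler :: "nat \<Rightarrow> aexp \<Rightarrow> com" where
  "sampler K e =
     Assign r_base (Const (int K * int K));; Assign r_idx (Const 0);; power_loop (int K);;
     Assign r_addr (Times (Const 2) (Reg 0));;
     Assign r_val (GF 0 (Divide (Const 1) (Reg r_base)));; extract_digits;;
     Assign r_addr (Plus (Times (Const 3) (Reg 0)) (Const 1));;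
     Assign r_val (Divide (Times (Divide (Const 1) (Reg r_base)) (GF 1 (Divide (Const 1) (Reg r_base))))
       (GF 0 (Divide (Const 1) (Reg r_base))));; extract_digits;;
     Assign r_rem (Reg 0);; sample_loop e;; Assign 0 (Reg r_out)"

text \<open>The \<open>4 * n + 2\<close> cells are \<open>2 * n\<close> for the output and
  \<open>n + 1\<close> for each table; the two equal summands in the step bound are the two digit
  extractions.\<close>

lemma sampler:
  assumes b: "\<And>k. 1 \<le> k \<Longrightarrow> 0 < b k"
    and e: "\<And>\<rho> k. \<rho> r_size = real k \<Longrightarrow> 1 \<le> k \<Longrightarrow> aval b \<rho> e = real (b k)"
    and K: "3 \<le> K" "\<And>k. num_wp b k \<le> K ^ k" "\<And>k. div_weight b k \<le> K ^ k"
    and L: "\<And>k. k \<le> n \<Longrightarrow> num_wp b k < 2 ^ L" "\<And>k. k \<le> n \<Longrightarrow> div_weight b k < 2 ^ L"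
    and M: "\<And>d. 1 \<le> d \<Longrightarrow> d \<le> n \<Longrightarrow> b d \<le> M" "1 \<le> M"
  shows "samples b (sampler K e) (init_state n) (pmf_of_set (weighted_partitions b n))
    (\<lambda>s' P. decode s' = Some P \<and> cells s' \<le> 4 * n + 2 \<and>
       steps s' \<le> 14 + 3 * n + 2 * ((n + 1) * (6 * L + 8)) + 61 * M * n)"
proof -
  define B where "B = real K ^ (n + 2)"
  have Kr: "3 \<le> real K" using K(1) by simp
  have B0: "B \<noteq> 0" using K(1) by (simp add: B_def)
  have c: "real (num_wp b k) \<le> real K ^ k" "real (div_weight b k) \<le> real K ^ k" for k
    using K(2,3)[of k] by (simp_all flip: of_nat_power)
  note conv = fps_conv_radius_exponential_coeffs[OF c(1) Kr B_def]
    fps_conv_radius_exponential_coeffs[OF c(2) Kr B_def]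
  have rad: "ereal \<bar>1 / B\<bar> < fps_conv_radius (counting_gf b)"
    using conv(1) by (simp only: counting_gf_def)
  have rad': "ereal \<bar>1 / B\<bar> < fps_conv_radius (fps_deriv (counting_gf b))"
    using rad fps_conv_radius_deriv[of "counting_gf b"] by (rule less_le_trans)
  note dc = digit_expansion[OF c(1) Kr B_def] and ds = digit_expansion[OF c(2) Kr B_def]
  define y where "y = (\<lambda>k. \<Sum>j. real (num_wp b (k + j)) * (1 / B) ^ j)"
  define z where "z = (\<lambda>k. \<Sum>j. real (div_weight b (k + j)) * (1 / B) ^ j)"
  have "0 < B" using K(1) by (simp add: B_def)
  have y0: "eval_fps (counting_gf b) (1 / B) = y 0"
    by (simp add: eval_fps_def counting_gf_def y_def)
  \<comment> \<open>The constant coefficient is 1 and the tail is nonnegative, so dividing by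
    \<open>y 0\<close> is legitimate.\<close>
  have "y 0 = real (num_wp b 0) + y (Suc 0) / B" "0 \<le> y (Suc 0)"
    unfolding y_def by (rule dc)+
  hence y0pos: "0 < y 0" using \<open>0 < B\<close> by (simp add: weighted_partitions_0 add_pos_nonneg)
  have z0: "1 / B * eval_fps (fps_deriv (counting_gf b)) (1 / B) / y 0 = z 0"
    using eval_div_weight_gf[OF rad conv(2)] y0 y0pos by (simp add: z_def)
  let ?V = "{r_val, r_idx, r_pow, r_frac}"
  show ?thesis
    unfolding sampler_def
  proof (simp only: samples_Assign_Seq, rule computes_Seq[OF power_loop[where n = n]], goal_cases)
    case (3 s1)
    hence s1: "regs s1 r_base = B" "regs s1 0 = real n" "regs s1 r_out = 0" "mem s1 = (\<lambda>_. 0)" "cells s1 = 0"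
        "steps s1 \<le> 3 * n + 3"
      by (auto simp: frame_def init_state_def B_def)
    show ?case
    proof (simp only: samples_Assign_Seq,
        rule computes_Seq[OF extract_digits[where n = n and B = B and addr = "2 * n" and y = y
            and a = "num_wp b" and L = L]], goal_cases)
      case (10 s2)
      hence s2: "regs s2 r_base = B" "regs s2 0 = real n" "regs s2 r_out = 0"
          "mem s2 = (\<lambda>x. if 2 * n \<le> x \<and> x \<le> 2 * n + n then real (num_wp b (x - 2 * n)) else 0)"
          "cells s2 \<le> 3 * n + 1" "steps s2 \<le> 7 + 3 * n + (n + 1) * (6 * L + 8)"
        using s1 by (auto simp: frame_def)
      show ?case
      proof (simp only: samples_Assign_Seq,
          rule computes_Seq[OF extract_digits[where n = n and B = B and addr = "3 * n + 1" and y = z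
              and a = "div_weight b" and L = L]], goal_cases)
        case (10 s3)
        hence s3: "regs s3 0 = real n" "regs s3 r_out = 0" "tables b n (mem s3)"
            "cells s3 \<le> 4 * n + 2" "steps s3 \<le> 11 + 3 * n + 2 * ((n + 1) * (6 * L + 8))"
          using s2 by (auto simp: frame_def tables_def)
        let ?s = "tick 1 (set_reg r_rem (aval b (regs s3) (Reg 0)) s3)"
        have "samples b (sample_loop e) ?s (pmf_of_set (weighted_partitions b n))
          (\<lambda>s' Q. \<exists>q'. regs s' r_out = real q' \<and> outputs (mem s') q' ({#} + Q) \<and> cells s' \<le> 4 * n + 2 \<and>
             steps s' \<le> steps ?s + 61 * M * n + 1)"
          by (rule sample_loop[where q = 0])
            (use b e M s3 in \<open>auto simp: outputs_def\<close>)
        hence "samples b (sample_loop e;; Assign 0 (Reg r_out)) ?s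
          (bind_pmf (pmf_of_set (weighted_partitions b n)) return_pmf) (\<lambda>s' P. decode s' = Some P \<and>
             cells s' \<le> 4 * n + 2 \<and> steps s' \<le> 14 + 3 * n + 2 * ((n + 1) * (6 * L + 8)) + 61 * M * n)"
          by (rule samples_Seq) (use s3 in \<open>auto simp: outputs_def decode_def\<close>)
        thus ?case by (simp add: bind_return_pmf')
      next
        case 4
        show ?case using s2 rad rad' y0 z0 by (simp add: gf_deriv_simps)
      next
        case (5 k)
        show ?case unfolding z_def by (rule ds)
      next
        case (6 k)
        show ?case unfolding z_def using ds(2)[of "Suc k"] \<open>0 < B\<close> by simp
      next
        case (7 k)
        thus ?case unfolding z_def by (rule ds)
      qed (use s2 B0 L in auto)
    next
      case 4
      show ?case using s1 rad y0 by (simp add: gf_deriv_simps)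
    next
      case (5 k)
      show ?case unfolding y_def by (rule dc)
    next
      case (6 k)
      show ?case unfolding y_def using dc(2)[of "Suc k"] \<open>0 < B\<close> by simp
    next
      case (7 k)
      thus ?case unfolding y_def by (rule dc)
    qed (use s1 B0 L in auto)
  qed (auto simp: init_state_def)
qed

text \<open>The joint distribution \<open>z\<close> has the run and the uniform distribution as
  marginals, and decoding agrees with the partition throughout its support. No mass lies on
  \<open>None\<close>, so a sure bound on the steps bounds the expectation.\<close>

lemma samples_run:
  assumes "samples b c (init_state n) (pmf_of_set A) (\<lambda>s' P. decode s' = Some P \<and> cells s' \<le> S \<and> steps s' \<le> T)"
    "finite A" "A \<noteq> {}"
  shows "output_dist b c n = spmf_of_set A" "expected_time b c n \<le> ennreal (real T)"
    "space_bounded b c n (real S)"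
proof -
  obtain z where z': "\<forall>r P. (r, P) \<in> set_pmf z \<longrightarrow>
      (\<exists>s'. r = Some s' \<and> decode s' = Some P \<and> cells s' \<le> S \<and> steps s' \<le> T)"
    and eqs: "map_pmf fst z = run b c n" "map_pmf snd z = pmf_of_set A"
    using assms(1) unfolding samples_def run_def by cases blast
  note z = z'[rule_format] and fst = eqs(1)[symmetric] and snd = eqs(2)[symmetric]
  have "output_dist b c n = bind_pmf z (\<lambda>x. case fst x of None \<Rightarrow> return_pmf None | Some s \<Rightarrow> return_pmf (decode s))"
    by (simp add: output_dist_def fst bind_spmf_def bind_map_pmf)
  also have "\<dots> = bind_pmf z (\<lambda>x. return_pmf (Some (snd x)))"
    by (rule bind_pmf_cong) (auto dest!: z)
  also have "\<dots> = map_pmf Some (map_pmf snd z)" by (simp add: map_pmf_def bind_assoc_pmf bind_return_pmf)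
  finally show "output_dist b c n = spmf_of_set A"
    using assms(2,3) by (simp add: snd spmf_of_set_def spmf_of_pmf_def)
  have run: "\<exists>s'. r = Some s' \<and> cells s' \<le> S \<and> steps s' \<le> T" if "r \<in> set_pmf (run b c n)" for r
  proof -
    from that obtain P where "(r, P) \<in> set_pmf z" by (auto simp: fst)
    thus ?thesis using z by blast
  qed
  have "expected_time b c n \<le> (\<integral>\<^sup>+ x. ennreal (real T) \<partial>measure_pmf (run b c n))"
    unfolding expected_time_def
    by (intro nn_integral_mono_AE)
       (auto simp: AE_measure_pmf_iff ennreal_of_nat_eq_real_of_nat dest!: run)
  also have "\<dots> = ennreal (real T)" by simp
  finally show "expected_time b c n \<le> ennreal (real T)" .
  show "space_bounded b c n (real S)"
    unfolding space_bounded_def using run by (force simp: in_set_spmf)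
qed

theorem theorem2:
  fixes r :: nat and b :: "nat \<Rightarrow> nat"
  assumes "pos_int_seq_of_degree r b"
  shows "\<exists>(prog :: com) (T :: nat \<Rightarrow> real) (S :: nat \<Rightarrow> real).
           T \<in> O(\<lambda>n. real n powr (real r + 1 + (real r + 3) / (2 * real r + 4))) \<and>
           S \<in> O(\<lambda>n. real n) \<and>
           (\<forall>n\<ge>1. output_dist b prog n = spmf_of_set (weighted_partitions b n) \<and>
                  expected_time b prog n \<le> ennreal (T n) \<and>
                  space_bounded b prog n (S n))"
proof -
  have b: "\<And>k. 1 \<le> k \<Longrightarrow> 0 < b k" using assms by (auto simp: pos_int_seq_of_degree_def)
  obtain e where e: "\<And>\<rho> k. \<rho> r_size = real k \<Longrightarrow> 1 \<le> k \<Longrightarrow> aval b \<rho> e = real (b k)"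
    using pos_int_seq_aexp[OF assms, where v = r_size] by blast
  obtain C where C: "1 \<le> C" "\<And>k. 1 \<le> k \<Longrightarrow> b k \<le> C * k ^ r" using pos_int_seq_bound[OF assms] by blast
  obtain K where K: "3 \<le> K" "\<And>k. num_wp b k \<le> K ^ k" "\<And>k. div_weight b k \<le> K ^ k"
    using exponential_bounds[OF assms] by blast
  \<comment> \<open>Exponent of the bit length; the tables cost order
    \<open>n powr (1 + \<beta>)\<close>.\<close>
  define \<beta> :: real where "\<beta> = (if r = 0 then 1 / 2 else 1)"
  obtain L A where L: "\<And>n k. k \<le> n \<Longrightarrow> num_wp b k < 2 ^ L n" "\<And>n k. k \<le> n \<Longrightarrow> div_weight b k < 2 ^ L n"
    and A: "0 \<le> A" "\<And>n. 1 \<le> n \<Longrightarrow> real (L n) \<le> A * real n powr \<beta>"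
    using num_wp_bit_length[OF assms] unfolding \<beta>_def by blast
  \<comment> \<open>The parameter \<open>M\<close> of \<open>sampler\<close> becomes
    \<open>C * n ^ r\<close>, which bounds \<open>b d\<close> for
    \<open>1 \<le> d \<le> n\<close>.\<close>
  define T :: "nat \<Rightarrow> nat" where
    "T = (\<lambda>n. 14 + 3 * n + 2 * ((n + 1) * (6 * L n + 8)) + 61 * (C * n ^ r) * n)"
  define \<alpha> where "\<alpha> = real r + 1 + (real r + 3) / (2 * real r + 4)"
  have \<alpha>: "1 + \<beta> \<le> \<alpha>" "real r + 1 \<le> \<alpha>" "1 \<le> \<alpha>" "0 \<le> \<alpha>"
  proof -
    have frac: "0 \<le> (real r + 3) / (2 * real r + 4)" by simp
    show "real r + 1 \<le> \<alpha>" using frac by (simp add: \<alpha>_def)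
    thus "1 \<le> \<alpha>" "0 \<le> \<alpha>" by simp_all
    \<comment> \<open>For \<open>r = 0\<close> this reads \<open>3 / 2 \<le> 7 / 4\<close>;
      otherwise \<open>2 \<le> r + 1\<close> suffices.\<close>
    show "1 + \<beta> \<le> \<alpha>"
    proof (cases "r = 0")
      case True
      thus ?thesis by (simp add: \<alpha>_def \<beta>_def)
    next
      case False
      hence "1 \<le> real r" by simp
      with \<open>real r + 1 \<le> \<alpha>\<close> False show ?thesis by (simp add: \<beta>_def)
    qed
  qed
  have Tle: "real (T n) \<le> (17 + 2 * (2 * (6 * A + 8)) + 61 * real C) * real n powr \<alpha>" if n: "1 \<le> n" for n
  proof -
    have pw: "real n powr x \<le> real n powr \<alpha>" if "x \<le> \<alpha>" for x
      using n that by (intro powr_mono) auto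
    have 1: "1 \<le> real n powr \<alpha>" using pw[of 0] \<alpha> n by simp
    have 2: "real n \<le> real n powr \<alpha>" using pw[of 1] \<alpha> n by simp
    have "(real n + 1) * (6 * real (L n) + 8) \<le> (2 * real n) * (6 * (A * real n powr \<beta>) + 8 * real n powr \<beta>)"
    proof (intro mult_mono add_mono)
      have "1 \<le> real n powr \<beta>" using n by (simp add: \<beta>_def ge_one_powr_ge_zero)
      thus "8 \<le> 8 * real n powr \<beta>" by simp
    qed (use n A in auto)
    also have "\<dots> = 2 * (6 * A + 8) * real n powr (1 + \<beta>)"
      using n by (simp add: powr_add algebra_simps)
    also have "\<dots> \<le> 2 * (6 * A + 8) * real n powr \<alpha>"
      using A(1) by (intro mult_left_mono pw \<alpha>) auto
    finally have 3: "(real n + 1) * (6 * real (L n) + 8) \<le> 2 * (6 * A + 8) * real n powr \<alpha>" .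
    have "real n ^ r * real n = real n powr (real r + 1)"
      using n by (simp add: powr_add powr_realpow)
    hence 4: "real n ^ r * real n \<le> real n powr \<alpha>" using pw[OF \<alpha>(2)] by simp
    have "real (T n) = 14 + 3 * real n + 2 * ((real n + 1) * (6 * real (L n) + 8)) +
            61 * real C * (real n ^ r * real n)"
      by (simp add: T_def algebra_simps)
    also have "\<dots> \<le> 14 * real n powr \<alpha> + 3 * real n powr \<alpha> + 2 * (2 * (6 * A + 8) * real n powr \<alpha>) +
            61 * real C * real n powr \<alpha>"
      using 1 2 3 4 by (intro add_mono mult_left_mono) auto
    finally show ?thesis by (simp add: algebra_simps)
  qed
  have O1: "(\<lambda>n. real (T n)) \<in> O(\<lambda>n. real n powr \<alpha>)"
    by (rule bigoI[where c = "17 + 2 * (2 * (6 * A + 8)) + 61 * real C"])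
      (use Tle in \<open>auto intro!: eventually_mono[OF eventually_ge_at_top[of 1]]\<close>)
  have O2: "(\<lambda>n. real (4 * n + 2)) \<in> O(\<lambda>n. real n)"
    by (rule bigoI[where c = 6]) (auto intro!: eventually_mono[OF eventually_ge_at_top[of 1]])
  have run: "output_dist b (sampler K e) n = spmf_of_set (weighted_partitions b n)"
    "expected_time b (sampler K e) n \<le> ennreal (real (T n))"
    "space_bounded b (sampler K e) n (real (4 * n + 2))" if n: "1 \<le> n" for n
  proof -
    have M: "b d \<le> C * n ^ r" if "1 \<le> d" "d \<le> n" for d
      using C(2)[OF that(1)] that by (meson order.trans mult_le_mono2 power_mono zero_le)
    have "samples b (sampler K e) (init_state n) (pmf_of_set (weighted_partitions b n))
      (\<lambda>s' P. decode s' = Some P \<and> cells s' \<le> 4 * n + 2 \<and> steps s' \<le> T n)"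
      unfolding T_def
      by (rule sampler) (use b e K L[of _ n] M C n in auto)
    note * = samples_run[OF this finite_weighted_partitions weighted_partitions_nonempty[of b n]]
    show "output_dist b (sampler K e) n = spmf_of_set (weighted_partitions b n)"
      "expected_time b (sampler K e) n \<le> ennreal (real (T n))"
      "space_bounded b (sampler K e) n (real (4 * n + 2))"
      by (rule *; use b in simp)+
  qed
  show ?thesis
    by (intro exI[of _ "sampler K e"] exI[of _ "\<lambda>n. real (T n)"] exI[of _ "\<lambda>n. real (4 * n + 2)"] conjI
        O1[unfolded \<alpha>_def] O2 allI impI run)
qed

end
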